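(* Assume (HY), (HV) and (H$\mathcal U$) as stated in the context. Then $$\sup_{\nu\in\mathcal U(\mathbb F)}\mathbb E[Y^\nu(T^n)]\ \le\ V_n(0)\ \le\ \int \sup_{\nu\in\mathcal U(\mathbb F)}\mathbb E[Y^\nu(z^1+\cdots+z^n)]\,m(dz),$$ where $z=(z^1,\dots,z^n)$.
   Context: Let $(\Omega,\mathcal A,\mathbb P)$ be a probability space with a filtration $\mathbb F=\{\mathcal F_t\}_{t\ge0}$ satisfying the usual conditions, with $\mathcal F_0$ trivial ($\mathcal A$ may be larger than $\mathcal F_\infty$). Controls: given a set $U$ of deterministic functions from $\mathbb R_+$ to $\mathbb R^d$, $d\ge1$, $\tilde{\mathcal U}(\mathbb F)$ is the collection of all $\mathbb F$-adapted processes $\nu$ such that $t\mapsto\nu(t,\omega)$ belongs to $U$ for almost every $\omega$. The controlled state process is given by a map $\nu\in\tilde{\mathcal U}(\mathbb F)\mapsto Y^\nu\in L^0_{\mathbb F}(\mathbb R_+\times\Omega,\mathbb R)$ (the set of real-valued $\mathbb F$-progressively measurable processes), where $Y^\nu(0)=Y(0)$ does not depend on $\nu$. The set of admissible controls $\mathcal U(\mathbb F)$ is a subset of $\tilde{\mathcal U}(\mathbb F)$. For $t\ge0$ and $\nu\in\mathcal U(\mathbb F)$, $\mathcal U(\mathbb F;t,\nu):=\{\mu\in\mathcal U(\mathbb F):\mu=\nu\text{ on }[0,t)\ \mathbb P\text{-a.s.}\}$. (H$\mathcal U$): for all $\nu_1,\nu_2\in\mathcal U(\mathbb F)$, $t\ge0$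 and $A\in\mathcal F_t$, if $\nu_1=\nu_2$ on $[0,t)$ $\mathbb P$-a.s., then $\nu_1\mathbf 1_A+\nu_2\mathbf 1_{A^c}\in\mathcal U(\mathbb F)$. Randomized maturities: $\mathcal I^{\mathbb F}$ is the collection of all nonnegative random variables on $(\Omega,\mathcal A,\mathbb P)$ which are independent of $\mathcal F_\infty$. Fix an integer $n\ge1$ and a sequence $(\zeta^j)_{1\le j\le n}$ of independent random variables in $\mathcal I^{\mathbb F}$. Set $T^k:=\sum_{j=1}^k\zeta^j$ for $1\le k\le n$, $T^0:=0$, and let $m$ be the law of $(\zeta^1,\dots,\zeta^n)$ under $\mathbb P$ (the product of the laws of the $\zeta^j$). Algorithm: for $\nu\in\mathcal U(\mathbb F)$, $V_0^\nu:=Y^\nu$, and for $k=0,\dots,n-1$, $$V_{k+1}^\nu(t):=\operatorname*{ess\,sup}_{\mu\in\mathcal U(\mathbb F;t,\nu)}\mathbb E[\bar V_k^\mu(t+\zeta^{n-k})\mid\mathcal F_t],\qquad t\ge0,$$ where $\bar V_0^\mu=V_0^\mu$ and, for $k\ge1$, $\bar V_k^\mu$ is the aggregating process of (HV). Since $\mathcal U(\mathbb F;0,\nu)=\mathcal U(\mathbb F)$, $V_k^\nu(0)$ does not depend on $\nu$; write $V_k(0):=V_k^\nu(0)$. (HY): there is a uniformly integrable martingale $M^Y$ such that, for each $\nu\in\mathcal U(\mathbb F)$, $|Y^\nu(t)|\le M^Y(t)$ for all $t\ge0$, $\mathbb P$-a.s. (HV): for each $\nu\in\mathcal U(\mathbb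 F)$ and $1\le k\le n-1$ there is a process $\bar V_k^\nu:\Omega\times\mathbb R_+\to\mathbb R$, measurable with respect to $\mathcal F_\infty\otimes\mathcal B_{\mathbb R_+}$, such that $\bar V_k^\nu(t)=V_k^\nu(t)$ $\mathbb P$-a.s. for all $t\ge0$.
   Formalization: Adds that (ζ^1,…,ζ^n) is jointly independent of F_∞ and that, for ν1=ν2 on [0,t) and A in F_t, Y of the pasted control is the pasted Y a.s. at each s≥t (the claim fails without either); the right integral is an upper integral, as the sup may be non-measurable. *)

theory Defs
  imports "HOL-Probability.Probability"
begin

text \<open>
  Time is the half-line of nonnegative reals, encoded by the type \<^typ>\<open>real\<close>; a process is a function
  of time first and of the scenario second. Every notion below looks only at times \<open>t \<ge> 0\<close>; a
  filtration indexed by the nonnegative reals is extended to negative times by \<open>F t = F 0\<close>.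
\<close>

definition usual_conditions :: "'w measure \<Rightarrow> (real \<Rightarrow> 'w measure) \<Rightarrow> bool" where
  "usual_conditions M F \<longleftrightarrow>
     complete_measure M \<and> null_sets M \<subseteq> sets (F 0) \<and>
     (\<forall>t\<ge>0. sets (F t) = (\<Inter>s\<in>{t<..}. sets (F s)))"

definition trivial_sigma_algebra :: "'w measure \<Rightarrow> 'w measure \<Rightarrow> bool" where
  "trivial_sigma_algebra M G \<longleftrightarrow> (\<forall>A\<in>sets G. measure M A = 0 \<or> measure M A = 1)"

definition F_infinity :: "'w measure \<Rightarrow> (real \<Rightarrow> 'w measure) \<Rightarrow> 'w measure" where
  "F_infinity M F = sigma (space M) (\<Union>t\<in>{0..}. sets (F t))"

definition adapted :: "(real \<Rightarrow> 'w measure) \<Rightarrow> (real \<Rightarrow> 'w \<Rightarrow> 'b::topological_space) \<Rightarrow> bool" where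
  "adapted F X \<longleftrightarrow> (\<forall>t\<ge>0. X t \<in> borel_measurable (F t))"

definition progressively_measurable :: "(real \<Rightarrow> 'w measure) \<Rightarrow> (real \<Rightarrow> 'w \<Rightarrow> real) \<Rightarrow> bool" where
  "progressively_measurable F X \<longleftrightarrow>
     (\<forall>t\<ge>0. (\<lambda>(s, \<omega>). X s \<omega>) \<in> borel_measurable (restrict_space borel {0..t} \<Otimes>\<^sub>M F t))"

definition martingale :: "'w measure \<Rightarrow> (real \<Rightarrow> 'w measure) \<Rightarrow> (real \<Rightarrow> 'w \<Rightarrow> real) \<Rightarrow> bool" where
  "martingale M F X \<longleftrightarrow>
     adapted F X \<and> (\<forall>t\<ge>0. integrable M (X t)) \<and>
     (\<forall>s\<ge>0. \<forall>t\<ge>s. AE \<omega> in M. real_cond_exp M (F s) (X t) \<omega> = X s \<omega>)"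

definition uniformly_integrable :: "'w measure \<Rightarrow> (real \<Rightarrow> 'w \<Rightarrow> real) \<Rightarrow> bool" where
  "uniformly_integrable M X \<longleftrightarrow>
     (\<forall>t\<ge>0. integrable M (X t)) \<and>
     (\<forall>e>0. \<exists>K. \<forall>t\<ge>0. (\<integral>\<omega>. \<bar>X t \<omega>\<bar> * indicator {\<omega>. \<bar>X t \<omega>\<bar> > K} \<omega> \<partial>M) \<le> e)"

text \<open>The tilde-version of the set of controls. By the restriction to \<open>{0..}\<close>, the set \<open>U\<close> consists of
  functions on the nonnegative half-line, in the extensional encoding.\<close>

definition pre_controls ::
  "'w measure \<Rightarrow> (real \<Rightarrow> 'w measure) \<Rightarrow> (real \<Rightarrow> real ^ 'd) set \<Rightarrow> (real \<Rightarrow> 'w \<Rightarrow> real ^ 'd) set" where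
  "pre_controls M F U =
     {\<nu>. adapted F \<nu> \<and> (AE \<omega> in M. restrict (\<lambda>t. \<nu> t \<omega>) {0..} \<in> U)}"

definition agree_before ::
  "'w measure \<Rightarrow> real \<Rightarrow> (real \<Rightarrow> 'w \<Rightarrow> 'b) \<Rightarrow> (real \<Rightarrow> 'w \<Rightarrow> 'b) \<Rightarrow> bool" where
  "agree_before M t \<mu> \<nu> \<longleftrightarrow> (AE \<omega> in M. \<forall>s\<in>{0..<t}. \<mu> s \<omega> = \<nu> s \<omega>)"

definition controls_from ::
  "'w measure \<Rightarrow> (real \<Rightarrow> 'w \<Rightarrow> 'b) set \<Rightarrow> real \<Rightarrow> (real \<Rightarrow> 'w \<Rightarrow> 'b) \<Rightarrow> (real \<Rightarrow> 'w \<Rightarrow> 'b) set" where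
  "controls_from M UF t \<nu> = {\<mu>\<in>UF. agree_before M t \<mu> \<nu>}"

definition paste ::
  "'w set \<Rightarrow> (real \<Rightarrow> 'w \<Rightarrow> 'b) \<Rightarrow> (real \<Rightarrow> 'w \<Rightarrow> 'b) \<Rightarrow> real \<Rightarrow> 'w \<Rightarrow> 'b" where
  "paste A \<nu>1 \<nu>2 = (\<lambda>t \<omega>. if \<omega> \<in> A then \<nu>1 t \<omega> else \<nu>2 t \<omega>)"

definition stable_under_pasting ::
  "'w measure \<Rightarrow> (real \<Rightarrow> 'w measure) \<Rightarrow> (real \<Rightarrow> 'w \<Rightarrow> 'b) set \<Rightarrow> bool" where
  "stable_under_pasting M F UF \<longleftrightarrow>
     (\<forall>\<nu>1\<in>UF. \<forall>\<nu>2\<in>UF. \<forall>t\<ge>0. \<forall>A\<in>sets (F t).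
        agree_before M t \<nu>1 \<nu>2 \<longrightarrow> paste A \<nu>1 \<nu>2 \<in> UF)"

text \<open>The state driven by a pasted control is the pasted state from time \<open>t\<close> on. This is what makes
  stability of the controls under pasting yield upward directed families of conditional
  expectations; it is not implied by stability alone, since \<open>Y\<close> is otherwise an arbitrary map.\<close>

definition local_in_control ::
  "'w measure \<Rightarrow> (real \<Rightarrow> 'w measure) \<Rightarrow> (real \<Rightarrow> 'w \<Rightarrow> 'b) set \<Rightarrow>
    ((real \<Rightarrow> 'w \<Rightarrow> 'b) \<Rightarrow> real \<Rightarrow> 'w \<Rightarrow> real) \<Rightarrow> bool" where
  "local_in_control M F UF Y \<longleftrightarrow>
     (\<forall>\<nu>1\<in>UF. \<forall>\<nu>2\<in>UF. \<forall>t\<ge>0. \<forall>A\<in>sets (F t).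
        agree_before M t \<nu>1 \<nu>2 \<longrightarrow>
        (\<forall>s\<ge>t. AE \<omega> in M. Y (paste A \<nu>1 \<nu>2) s \<omega> = paste A (Y \<nu>1) (Y \<nu>2) s \<omega>))"

definition independent_of :: "'w measure \<Rightarrow> 'b measure \<Rightarrow> ('w \<Rightarrow> 'b) \<Rightarrow> 'w measure \<Rightarrow> bool" where
  "independent_of M N X G \<longleftrightarrow>
     X \<in> M \<rightarrow>\<^sub>M N \<and>
     prob_space.indep_set M {X -` B \<inter> space M | B. B \<in> sets N} (sets G)"

definition randomized_maturities :: "'w measure \<Rightarrow> (real \<Rightarrow> 'w measure) \<Rightarrow> ('w \<Rightarrow> real) set" where
  "randomized_maturities M F =
     {\<zeta>. (\<forall>\<omega>\<in>space M. 0 \<le> \<zeta> \<omega>) \<and> independent_of M borel \<zeta> (F_infinity M F)}"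

definition maturity_vector :: "nat \<Rightarrow> (nat \<Rightarrow> 'w \<Rightarrow> real) \<Rightarrow> 'w \<Rightarrow> nat \<Rightarrow> real" where
  "maturity_vector n \<zeta> \<omega> = (\<lambda>j\<in>{1..n}. \<zeta> j \<omega>)"

definition maturity_law :: "'w measure \<Rightarrow> nat \<Rightarrow> (nat \<Rightarrow> 'w \<Rightarrow> real) \<Rightarrow> (nat \<Rightarrow> real) measure" where
  "maturity_law M n \<zeta> = distr M (Pi\<^sub>M {1..n} (\<lambda>_. borel)) (maturity_vector n \<zeta>)"

definition maturity_time :: "(nat \<Rightarrow> 'w \<Rightarrow> real) \<Rightarrow> nat \<Rightarrow> 'w \<Rightarrow> real" where
  "maturity_time \<zeta> k \<omega> = (\<Sum>j=1..k. \<zeta> j \<omega>)"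

text \<open>\<open>X\<close> is a version of the essential supremum of the family \<open>S\<close> of random variables, which need not
  be countable.\<close>

definition is_ess_sup :: "'w measure \<Rightarrow> ('w \<Rightarrow> ereal) set \<Rightarrow> ('w \<Rightarrow> ereal) \<Rightarrow> bool" where
  "is_ess_sup M S X \<longleftrightarrow>
     X \<in> borel_measurable M \<and>
     (\<forall>Z\<in>S. AE \<omega> in M. Z \<omega> \<le> X \<omega>) \<and>
     (\<forall>X'\<in>borel_measurable M. (\<forall>Z\<in>S. AE \<omega> in M. Z \<omega> \<le> X' \<omega>) \<longrightarrow> (AE \<omega> in M. X \<omega> \<le> X' \<omega>))"

text \<open>\<open>V\<close> and \<open>Vbar\<close> are produced by the backward algorithm. Conditional expectations and essential
  suprema are determined only up to null sets, so this is a relation that holds for every choice of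
  versions. For \<open>k \<ge> 1\<close> the processes \<open>Vbar k\<close> are tied to \<open>V k\<close> by \<open>aggregates\<close> below.\<close>

definition maturity_algorithm ::
  "'w measure \<Rightarrow> (real \<Rightarrow> 'w measure) \<Rightarrow> (real \<Rightarrow> 'w \<Rightarrow> 'b) set \<Rightarrow>
    ((real \<Rightarrow> 'w \<Rightarrow> 'b) \<Rightarrow> real \<Rightarrow> 'w \<Rightarrow> real) \<Rightarrow> nat \<Rightarrow> (nat \<Rightarrow> 'w \<Rightarrow> real) \<Rightarrow>
    (nat \<Rightarrow> (real \<Rightarrow> 'w \<Rightarrow> 'b) \<Rightarrow> real \<Rightarrow> 'w \<Rightarrow> ereal) \<Rightarrow>
    (nat \<Rightarrow> (real \<Rightarrow> 'w \<Rightarrow> 'b) \<Rightarrow> real \<Rightarrow> 'w \<Rightarrow> real) \<Rightarrow> bool" where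
  "maturity_algorithm M F UF Y n \<zeta> V Vbar \<longleftrightarrow>
     (\<forall>\<nu>\<in>UF. V 0 \<nu> = (\<lambda>t \<omega>. ereal (Y \<nu> t \<omega>)) \<and> Vbar 0 \<nu> = Y \<nu>) \<and>
     (\<forall>k<n. \<forall>\<nu>\<in>UF. \<forall>t\<ge>0.
        is_ess_sup M
          ((\<lambda>\<mu> \<omega>. ereal (real_cond_exp M (F t) (\<lambda>\<omega>'. Vbar k \<mu> (t + \<zeta> (n - k) \<omega>') \<omega>') \<omega>))
             ` controls_from M UF t \<nu>)
          (V (Suc k) \<nu> t))"

definition aggregates ::
  "'w measure \<Rightarrow> (real \<Rightarrow> 'w measure) \<Rightarrow> (real \<Rightarrow> 'w \<Rightarrow> real) \<Rightarrow> (real \<Rightarrow> 'w \<Rightarrow> ereal) \<Rightarrow> bool" where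
  "aggregates M F Xbar X \<longleftrightarrow>
     (\<lambda>(\<omega>, t). Xbar t \<omega>) \<in> borel_measurable (F_infinity M F \<Otimes>\<^sub>M restrict_space borel {0..}) \<and>
     (\<forall>t\<ge>0. AE \<omega> in M. ereal (Xbar t \<omega>) = X t \<omega>)"

text \<open>A supremum over an uncountable set of controls need not be measurable, so it is integrated in
  the sense of the upper integral. This is the Lebesgue integral whenever the latter exists, see the
  lemma below; the Bochner integral of the library would be 0 on nonmeasurable functions.\<close>

definition upper_integral :: "'b measure \<Rightarrow> ('b \<Rightarrow> ereal) \<Rightarrow> ereal" where
  "upper_integral N g =
     (INF h\<in>{h. integrable N h \<and> (AE z in N. g z \<le> ereal (h z))}. ereal (\<integral>z. h z \<partial>N))"

lemma upper_integral_eq_integral: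
  fixes f :: "'b \<Rightarrow> real"
  assumes "integrable (completion N) f"
  shows "upper_integral N (\<lambda>z. ereal (f z)) = ereal (\<integral>z. f z \<partial>completion N)"
proof -
  obtain f' where f': "f' \<in> borel_measurable N" "AE z in N. f z = f' z"
    using completion_ex_borel_measurable_real[OF borel_measurable_integrable[OF assms]] by blast
  have ae: "AE z in completion N. f z = f' z"
    using f'(2) by (rule AE_completion)
  have f_c: "f \<in> borel_measurable (completion N)"
    using assms by (rule borel_measurable_integrable)
  have f'_c: "f' \<in> borel_measurable (completion N)"
    using f'(1) by (rule measurable_completion)
  have "integrable (completion N) f'"
    using integrable_cong_AE[OF f_c f'_c ae] assms by (rule iffD1)
  then have int: "integrable N f'"
    using integrable_completion[OF f'(1)] by (rule iffD1[rotated])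
  have eq: "(\<integral>z. f z \<partial>completion N) = (\<integral>z. f' z \<partial>N)"
    using integral_cong_AE[OF f_c f'_c ae] integral_completion[OF f'(1)] by (rule trans)
  show ?thesis
    unfolding upper_integral_def eq
  proof (rule antisym)
    show "(INF h\<in>{h. integrable N h \<and> (AE z in N. ereal (f z) \<le> ereal (h z))}. ereal (\<integral>z. h z \<partial>N))
        \<le> ereal (\<integral>z. f' z \<partial>N)"
      using int f'(2) by (intro INF_lower) auto
    show "ereal (\<integral>z. f' z \<partial>N)
        \<le> (INF h\<in>{h. integrable N h \<and> (AE z in N. ereal (f z) \<le> ereal (h z))}. ereal (\<integral>z. h z \<partial>N))"
    proof (rule INF_greatest)
      fix h assume "h \<in> {h. integrable N h \<and> (AE z in N. ereal (f z) \<le> ereal (h z))}"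
      then have h: "integrable N h" "AE z in N. f z \<le> h z" by auto
      have "AE z in N. f' z \<le> h z" using h(2) f'(2) by eventually_elim simp
      then show "ereal (\<integral>z. f' z \<partial>N) \<le> ereal (\<integral>z. h z \<partial>N)"
        using integral_mono_AE[OF int h(1)] by simp
    qed
  qed
qed

end

theory Submission
  imports Defs
begin

text \<open>
  The algorithm replaces one randomized maturity at a time by an optimal control problem, and the
  whole argument takes place at the level of plain expectations. Write \<open>m\<^sub>j\<close> for the law of \<open>\<zeta>\<^sup>j\<close>.
  The key fact is the recursion

  \<open>E[V\<^sub>k\<^sub>+\<^sub>1\<^sup>\<nu>(t)] = sup\<^sub>\<mu> \<integral> E[V\<^sub>k\<^sup>\<mu>(t + z)] m\<^sub>n\<^sub>-\<^sub>k(dz)\<close>,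

  where \<open>\<mu>\<close> ranges over the controls that agree with \<open>\<nu>\<close> before \<open>t\<close>. It combines two exchanges.
  First, \<open>\<zeta>\<^sup>n\<^sup>-\<^sup>k\<close> is independent of \<open>F\<^sub>\<infinity>\<close> and the aggregated value is jointly measurable, so Fubini
  turns the evaluation at the random time \<open>t + \<zeta>\<^sup>n\<^sup>-\<^sup>k\<close> into an integral over its law
  (\<open>integral_at_independent\<close>). Second, the expectation of an essential supremum is the supremum of
  the expectations once the family is directed upwards (\<open>directed_ess_sup_integral_le\<close>). Given two
  controls, pasting them along the event where the first one has the larger continuation value
  dominates both (\<open>continuations_directed\<close>); for this the values of all stages have to be local in
  the control, a property that the recursion inherits from \<open>Y\<close> (\<open>V_local\<close>). All integrals exist
  because the bound \<open>|Y| \<le> M\<^sup>Y\<close> propagates: a martingale bound survives conditional expectation at a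
  later independent time and essential suprema (\<open>V_dominated\<close>).

  Both inequalities now follow by induction along the algorithm. For the lower bound one keeps the
  control \<open>\<nu>\<close> in every stage (\<open>mean_value_ge\<close>). For the upper bound, let \<open>h\<close> be an integrable function
  with \<open>E[Y\<^sup>\<mu>(z\<^sup>1 + \<dots> + z\<^sup>n)] \<le> h z\<close> for all controls \<open>\<mu>\<close> and almost every \<open>z\<close>. Integrating out the
  last coordinates of \<open>h\<close> one by one yields, at every stage, a function of the remaining ones that
  bounds the integrand of the recursion whatever control is used (\<open>mean_value_le\<close>); only the given \<open>h\<close>
  is ever integrated, never a supremum over controls. Taking the infimum over \<open>h\<close> gives the upper
  integral. Finally \<open>V\<^sub>n(0)\<close> is constant because \<open>F\<^sub>0\<close> is trivial (\<open>initial_value_constant\<close>).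
\<close>

section \<open>Random times independent of the filtration\<close>

context prob_space
begin

text \<open>
  For the identity as a map into the smaller \<open>\<sigma>\<close>-algebra, independence of \<open>Z\<close> from \<open>G\<close> says that the
  joint law is a product measure. The two components take values in different types, so the
  identity is checked on rectangles.
\<close>
lemma distr_independent_Pair:
  assumes Z: "independent_of M N Z G" and G: "subalgebra M G"
  shows "distr M (N \<Otimes>\<^sub>M G) (\<lambda>\<omega>. (Z \<omega>, \<omega>)) = distr M N Z \<Otimes>\<^sub>M distr M G (\<lambda>\<omega>. \<omega>)"
proof -
  have Zm: "Z \<in> M \<rightarrow>\<^sub>M N" and ind: "indep_set {Z -` B \<inter> space M | B. B \<in> sets N} (sets G)"
    using Z by (auto simp: independent_of_def)
  have spG: "space G = space M" and G_sub: "sets G \<subseteq> sets M"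
    using G by (auto simp: subalgebra_def)
  have id: "(\<lambda>\<omega>. \<omega>) \<in> M \<rightarrow>\<^sub>M G"
    using G by (intro measurable_ident_sets measurable_from_subalg[OF G]) auto
  interpret Z: prob_space "distr M N Z" by (rule prob_space_distr) fact
  interpret G: prob_space "distr M G (\<lambda>\<omega>. \<omega>)" by (rule prob_space_distr) fact
  have pair[measurable]: "(\<lambda>\<omega>. (Z \<omega>, \<omega>)) \<in> M \<rightarrow>\<^sub>M N \<Otimes>\<^sub>M G"
    using Zm id by (rule measurable_Pair)
  show ?thesis
  proof (rule pair_measure_eqI[symmetric])
    fix B A assume "B \<in> sets (distr M N Z)" "A \<in> sets (distr M G (\<lambda>\<omega>. \<omega>))"
    then have B: "B \<in> sets N" and A: "A \<in> sets G" by auto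
    have A_M: "A \<inter> space M = A"
      using sets.sets_into_space[OF A] spG by auto
    have "emeasure (distr M N Z) B * emeasure (distr M G (\<lambda>\<omega>. \<omega>)) A
        = emeasure M (Z -` B \<inter> space M) * emeasure M A"
      using A B id Zm A_M by (simp add: emeasure_distr)
    also have "\<dots> = emeasure M ((Z -` B \<inter> space M) \<inter> A)"
    proof -
      have "prob ((Z -` B \<inter> space M) \<inter> A) = prob (Z -` B \<inter> space M) * prob A"
        using B by (intro indep_setD[OF ind _ A]) blast
      then show ?thesis by (simp add: emeasure_eq_measure ennreal_mult'')
    qed
    also have "(Z -` B \<inter> space M) \<inter> A = (\<lambda>\<omega>. (Z \<omega>, \<omega>)) -` (B \<times> A) \<inter> space M"
      using A_M by auto
    also have "emeasure M \<dots> = emeasure (distr M (N \<Otimes>\<^sub>M G) (\<lambda>\<omega>. (Z \<omega>, \<omega>))) (B \<times> A)"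
      using A B pair by (subst emeasure_distr) auto
    finally show "emeasure (distr M N Z) B * emeasure (distr M G (\<lambda>\<omega>. \<omega>)) A
        = emeasure (distr M (N \<Otimes>\<^sub>M G) (\<lambda>\<omega>. (Z \<omega>, \<omega>))) (B \<times> A)" .
  qed (auto intro: Z.sigma_finite_measure_axioms G.sigma_finite_measure_axioms cong: sets_pair_measure_cong)
qed

text \<open>
  A property that holds almost surely at each deterministic \<open>z\<close> may fail at a general random one, as
  the exceptional null set depends on \<open>z\<close>; independence excludes this.
\<close>
lemma AE_at_independent:
  assumes Z: "independent_of M N Z G" and G: "subalgebra M G"
    and P: "{p \<in> space (N \<Otimes>\<^sub>M G). P p} \<in> sets (N \<Otimes>\<^sub>M G)"
    and ae: "AE z in distr M N Z. AE \<omega> in M. P (z, \<omega>)"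
  shows "AE \<omega> in M. P (Z \<omega>, \<omega>)"
proof -
  have Zm[measurable]: "Z \<in> M \<rightarrow>\<^sub>M N"
    using Z by (auto simp: independent_of_def)
  have id[measurable]: "(\<lambda>\<omega>. \<omega>) \<in> M \<rightarrow>\<^sub>M G"
    using G by (intro measurable_ident_sets measurable_from_subalg[OF G]) auto
  interpret Z: prob_space "distr M N Z" by (rule prob_space_distr) fact
  interpret G: prob_space "distr M G (\<lambda>\<omega>. \<omega>)" by (rule prob_space_distr) fact
  interpret pair_sigma_finite "distr M N Z" "distr M G (\<lambda>\<omega>. \<omega>)" ..
  have P_pred[measurable]: "Measurable.pred (N \<Otimes>\<^sub>M G) P"
    using P by (simp add: pred_def)
  have "AE z in distr M N Z. AE \<omega> in distr M G (\<lambda>\<omega>. \<omega>). P (z, \<omega>)"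
    using ae AE_space[of "distr M N Z"]
  proof eventually_elim
    case (elim z)
    then have "z \<in> space N" by simp
    then have "{\<omega> \<in> space G. P (z, \<omega>)} \<in> sets G" by measurable
    with elim show ?case by (subst AE_distr_iff) auto
  qed
  then have "AE p in distr M N Z \<Otimes>\<^sub>M distr M G (\<lambda>\<omega>. \<omega>). P p"
    using P by (intro AE_pair_measure) (auto simp: space_pair_measure cong: sets_pair_measure_cong)
  then have "AE p in distr M (N \<Otimes>\<^sub>M G) (\<lambda>\<omega>. (Z \<omega>, \<omega>)). P p"
    by (subst distr_independent_Pair[OF Z G])
  then show ?thesis
    using P by (subst (asm) AE_distr_iff) auto
qed

text \<open>
  Fubini under the product law. The uniform bound \<open>C\<close> on the first moments of the sections is what
  makes \<open>f\<close> integrable for the product.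
\<close>
lemma
  fixes f :: "'c \<times> 'a \<Rightarrow> real"
  assumes Z: "independent_of M N Z G" and G: "subalgebra M G"
    and f: "f \<in> borel_measurable (N \<Otimes>\<^sub>M G)"
    and int: "AE z in distr M N Z. integrable M (\<lambda>\<omega>. f (z, \<omega>)) \<and> (\<integral>\<omega>. \<bar>f (z, \<omega>)\<bar> \<partial>M) \<le> C"
  shows integrable_at_independent: "integrable M (\<lambda>\<omega>. f (Z \<omega>, \<omega>))"
    and integrable_section_integral: "integrable (distr M N Z) (\<lambda>z. \<integral>\<omega>. f (z, \<omega>) \<partial>M)"
    and integral_at_independent:
      "(\<integral>\<omega>. f (Z \<omega>, \<omega>) \<partial>M) = (\<integral>z. (\<integral>\<omega>. f (z, \<omega>) \<partial>M) \<partial>distr M N Z)"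
proof -
  have Zm[measurable]: "Z \<in> M \<rightarrow>\<^sub>M N"
    using Z by (auto simp: independent_of_def)
  have id[measurable]: "(\<lambda>\<omega>. \<omega>) \<in> M \<rightarrow>\<^sub>M G"
    using G by (intro measurable_ident_sets measurable_from_subalg[OF G]) auto
  note f[measurable]
  let ?Z = "distr M N Z" and ?G = "distr M G (\<lambda>\<omega>. \<omega>)"
  interpret Z: prob_space ?Z by (rule prob_space_distr) fact
  interpret G: prob_space ?G by (rule prob_space_distr) fact
  interpret pair_sigma_finite ?Z ?G ..
  have sec[measurable]: "(\<lambda>\<omega>. f (z, \<omega>)) \<in> borel_measurable G" if "z \<in> space N" for z
    using that by measurable
  have sec_int: "(\<integral>\<omega>. f (z, \<omega>) \<partial>?G) = (\<integral>\<omega>. f (z, \<omega>) \<partial>M)"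
    and sec_int_abs: "(\<integral>\<omega>. \<bar>f (z, \<omega>)\<bar> \<partial>?G) = (\<integral>\<omega>. \<bar>f (z, \<omega>)\<bar> \<partial>M)"
    and sec_able: "integrable ?G (\<lambda>\<omega>. f (z, \<omega>)) \<longleftrightarrow> integrable M (\<lambda>\<omega>. f (z, \<omega>))"
    if "z \<in> space N" for z
    using sec[OF that] by (auto simp: integral_distr integrable_distr_eq)
  have f': "f \<in> borel_measurable (?Z \<Otimes>\<^sub>M ?G)" by measurable
  have m_abs: "(\<lambda>z. \<integral>\<omega>. \<bar>f (z, \<omega>)\<bar> \<partial>?G) \<in> borel_measurable ?Z"
    using f' by measurable
  have *: "AE z in ?Z. integrable ?G (\<lambda>\<omega>. f (z, \<omega>)) \<and> (\<integral>\<omega>. \<bar>f (z, \<omega>)\<bar> \<partial>?G) \<le> C"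
    using int AE_space by eventually_elim (auto simp: sec_able sec_int_abs)
  have prod: "integrable (?Z \<Otimes>\<^sub>M ?G) f"
  proof (rule Fubini_integrable[OF f'])
    show "integrable ?Z (\<lambda>z. \<integral>\<omega>. norm (f (z, \<omega>)) \<partial>?G)"
      using m_abs * by (intro Z.integrable_const_bound[where B = C]) (auto elim: eventually_mono)
    show "AE z in ?Z. integrable ?G (\<lambda>\<omega>. f (z, \<omega>))"
      using * by eventually_elim auto
  qed
  then have joint: "integrable (distr M (N \<Otimes>\<^sub>M G) (\<lambda>\<omega>. (Z \<omega>, \<omega>))) f"
    by (simp add: distr_independent_Pair[OF Z G])
  then show "integrable M (\<lambda>\<omega>. f (Z \<omega>, \<omega>))"
    by (subst (asm) integrable_distr_eq) auto
  have "integrable ?Z (\<lambda>z. \<integral>\<omega>. f (z, \<omega>) \<partial>?G)"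
    using integrable_fst'[OF prod] .
  then show "integrable ?Z (\<lambda>z. \<integral>\<omega>. f (z, \<omega>) \<partial>M)"
    by (rule Bochner_Integration.integrable_cong[THEN iffD1, OF refl, rotated]) (auto simp: sec_int)
  have "(\<integral>\<omega>. f (Z \<omega>, \<omega>) \<partial>M) = (\<integral>p. f p \<partial>distr M (N \<Otimes>\<^sub>M G) (\<lambda>\<omega>. (Z \<omega>, \<omega>)))"
    by (subst integral_distr) auto
  also have "\<dots> = (\<integral>z. (\<integral>\<omega>. f (z, \<omega>) \<partial>?G) \<partial>?Z)"
    using integral_fst'[OF prod] by (simp add: distr_independent_Pair[OF Z G])
  also have "\<dots> = (\<integral>z. (\<integral>\<omega>. f (z, \<omega>) \<partial>M) \<partial>?Z)"
    by (rule Bochner_Integration.integral_cong) (auto simp: sec_int)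
  finally show "(\<integral>\<omega>. f (Z \<omega>, \<omega>) \<partial>M) = (\<integral>z. (\<integral>\<omega>. f (z, \<omega>) \<partial>M) \<partial>?Z)" .
qed

end

section \<open>Conditional expectations\<close>

text \<open>
  Testing the inequality on the event where the conditional expectation exceeds \<open>Z\<close> shows that this
  event is null.
\<close>
lemma (in sigma_finite_subalgebra) real_cond_exp_le:
  assumes X: "integrable M X" and Z: "integrable M Z" "Z \<in> borel_measurable F"
    and le: "\<And>A. A \<in> sets F \<Longrightarrow> (\<integral>x\<in>A. X x \<partial>M) \<le> (\<integral>x\<in>A. Z x \<partial>M)"
  shows "AE x in M. real_cond_exp M F X x \<le> Z x"
proof -
  let ?E = "real_cond_exp M F X"
  define A where "A = {x \<in> space F. Z x < ?E x}"
  have A: "A \<in> sets F" unfolding A_def using Z(2) by measurable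
  then have AM: "A \<in> sets M" using subalg by (auto simp: subalgebra_def)
  have spF: "space F = space M" using subalg by (auto simp: subalgebra_def)
  have E: "integrable M ?E" using X by (rule real_cond_exp_int)
  have iE: "set_integrable M A ?E" and iZ: "set_integrable M A Z"
    using integrable_mult_indicator[OF AM E] integrable_mult_indicator[OF AM Z(1)]
    by (simp_all add: set_integrable_def)
  have int: "set_integrable M A (\<lambda>x. ?E x - Z x)"
    using iE iZ by (rule set_integral_diff(1))
  have "(\<integral>x\<in>A. ?E x - Z x \<partial>M) = (\<integral>x\<in>A. X x \<partial>M) - (\<integral>x\<in>A. Z x \<partial>M)"
    using set_integral_diff(2)[OF iE iZ] real_cond_exp_intA[OF X A] by simp
  also have "\<dots> \<le> 0" using le[OF A] by simp
  finally have le0: "(\<integral>x. indicator A x * (?E x - Z x) \<partial>M) \<le> 0"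
    by (simp add: set_lebesgue_integral_def)
  have nn: "AE x in M. 0 \<le> indicator A x * (?E x - Z x)"
    by (auto simp: A_def indicator_def)
  have "integrable M (\<lambda>x. indicator A x * (?E x - Z x))"
    using int by (simp add: set_integrable_def)
  then have "AE x in M. indicator A x * (?E x - Z x) = 0"
    using integral_nonneg_eq_0_iff_AE[OF _ nn] le0 integral_nonneg_AE[OF nn] by auto
  then show ?thesis
    using AE_space by eventually_elim (auto simp: A_def spF indicator_def split: if_splits)
qed

lemma (in prob_space) real_cond_exp_trivial:
  assumes G: "subalgebra M G" and triv: "trivial_sigma_algebra M G" and X: "integrable M X"
  shows "AE x in M. real_cond_exp M G X x = expectation X"
proof -
  interpret finite_measure_subalgebra M G by standard (rule G)
  show ?thesis
  proof (rule real_cond_exp_charact)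
    fix A assume A: "A \<in> sets G"
    then have AM: "A \<in> events" using G by (auto simp: subalgebra_def)
    from triv A consider "prob A = 0" | "prob A = 1" by (auto simp: trivial_sigma_algebra_def)
    then show "(\<integral>x\<in>A. X x \<partial>M) = (\<integral>x\<in>A. expectation X \<partial>M)"
    proof cases
      case 1
      then have "AE x in M. x \<notin> A" using AM by (simp add: prob_eq_0)
      then show ?thesis
        unfolding set_lebesgue_integral_def
        using AM X by (intro integral_cong_AE) auto
    next
      case 2
      then have "AE x in M. x \<in> A" using AM by (simp add: prob_eq_1)
      then have "(\<integral>x\<in>A. f x \<partial>M) = expectation f" if "f \<in> borel_measurable M" for f
        unfolding set_lebesgue_integral_def
        using AM that by (intro integral_cong_AE) auto
      from this[of X] this[of "\<lambda>_. expectation X"] show ?thesis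
        using X by (simp add: prob_space)
    qed
  qed (use X in auto)
qed

section \<open>Essential suprema of directed families\<close>

lemma is_ess_sup_cong_AE:
  assumes "is_ess_sup M S X" "X' \<in> borel_measurable M" "AE \<omega> in M. X \<omega> = X' \<omega>"
  shows "is_ess_sup M S X'"
  unfolding is_ess_sup_def
proof (intro conjI ballI impI)
  show "X' \<in> borel_measurable M" by fact
next
  fix Z assume "Z \<in> S"
  then have "AE \<omega> in M. Z \<omega> \<le> X \<omega>" using assms(1) by (auto simp: is_ess_sup_def)
  then show "AE \<omega> in M. Z \<omega> \<le> X' \<omega>" using assms(3) by eventually_elim simp
next
  fix W assume "W \<in> borel_measurable M" "\<forall>Z\<in>S. AE \<omega> in M. Z \<omega> \<le> W \<omega>"
  then have "AE \<omega> in M. X \<omega> \<le> W \<omega>" using assms(1) by (auto simp: is_ess_sup_def)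
  then show "AE \<omega> in M. X' \<omega> \<le> W \<omega>" using assms(3) by eventually_elim simp
qed

text \<open>
  Choose an increasing sequence \<open>g\<close> in \<open>S\<close> whose integrals approach their supremum over \<open>S\<close>. A member
  \<open>h\<close> of \<open>S\<close> cannot exceed the limit of \<open>g\<close> on a set of positive measure: a common upper bound of \<open>h\<close>
  and \<open>g n\<close> in \<open>S\<close> would have an integral above that supremum. Hence the limit is the
  essential supremum, and dominated convergence gives the bound for its integral.
\<close>
lemma directed_ess_sup_integral_le:
  fixes S :: "('a \<Rightarrow> real) set"
  assumes S: "S \<noteq> {}" "\<And>f. f \<in> S \<Longrightarrow> integrable M f"
    and directed: "\<And>f g. f \<in> S \<Longrightarrow> g \<in> S \<Longrightarrow> \<exists>h\<in>S. AE x in M. f x \<le> h x \<and> g x \<le> h x"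
    and le: "\<And>f. f \<in> S \<Longrightarrow> (\<integral>x. f x \<partial>M) \<le> c"
    and X: "is_ess_sup M ((\<lambda>f x. ereal (f x)) ` S) (\<lambda>x. ereal (R x))"
    and R: "integrable M R"
  shows "(\<integral>x. R x \<partial>M) \<le> c"
proof -
  define s where "s = (SUP f\<in>S. \<integral>x. f x \<partial>M)"
  have bdd: "bdd_above ((\<lambda>f. \<integral>x. f x \<partial>M) ` S)"
    using le by (intro bdd_aboveI2)
  have le_s: "(\<integral>x. f x \<partial>M) \<le> s" if "f \<in> S" for f
    unfolding s_def using that bdd by (rule cSUP_upper)
  have "\<exists>f\<in>S. s - 1 / Suc n < (\<integral>x. f x \<partial>M)" for n
  proof (rule ccontr)
    assume "\<not> ?thesis"
    then have "s \<le> s - 1 / Suc n"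
      unfolding s_def using S(1) by (intro cSUP_least) (auto simp: not_less)
    then show False by simp
  qed
  then obtain f where f: "\<And>n. f n \<in> S" "\<And>n. s - 1 / Suc n < (\<integral>x. f n x \<partial>M)"
    by metis
  \<comment> \<open>Directedness replaces the maximizing sequence by an increasing one that stays in \<open>S\<close>.\<close>
  have "\<exists>g. \<forall>n. (g n \<in> S \<and> (AE x in M. f n x \<le> g n x)) \<and> (AE x in M. g n x \<le> g (Suc n) x)"
  proof (rule dependent_nat_choice)
    show "\<exists>g. g \<in> S \<and> (AE x in M. f 0 x \<le> g x)" using f(1) by auto
    fix g n assume "g \<in> S \<and> (AE x in M. f n x \<le> g x)"
    then show "\<exists>h. (h \<in> S \<and> (AE x in M. f (Suc n) x \<le> h x)) \<and> (AE x in M. g x \<le> h x)"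
      using directed[of g "f (Suc n)"] f(1)[of "Suc n"] by (auto elim: eventually_mono)
  qed
  then obtain g where g: "\<And>n. g n \<in> S" "\<And>n. AE x in M. f n x \<le> g n x"
      "\<And>n. AE x in M. g n x \<le> g (Suc n) x"
    by metis
  have g_int: "integrable M (g n)" for n using S(2) g(1) .
  have g_lower: "s - 1 / Suc n < (\<integral>x. g n x \<partial>M)" for n
    using f(2)[of n] integral_mono_AE[OF S(2)[OF f(1)] g_int g(2)] by (rule less_le_trans)
  have [measurable]: "g n \<in> borel_measurable M" for n
    using g_int by (rule borel_measurable_integrable)
  have g_le_R: "AE x in M. g n x \<le> R x" for n
    using X g(1) by (auto simp: is_ess_sup_def)
  define G where "G x = (SUP n. ereal (g n x))" for x
  have G_meas[measurable]: "G \<in> borel_measurable M" unfolding G_def by measurable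
  have "AE x in M. ereal (h x) \<le> G x" if h: "h \<in> S" for h
  proof -
    have hm[measurable]: "integrable M h" using S(2)[OF h] .
    have [measurable]: "h \<in> borel_measurable M" using hm by (rule borel_measurable_integrable)
    have excess: "(\<integral>x. max 0 (h x - g n x) \<partial>M) \<le> 1 / Suc n" for n
    proof -
      obtain k where k: "k \<in> S" "AE x in M. h x \<le> k x \<and> g n x \<le> k x"
        using directed[OF h g(1)[of n]] by auto
      have "(\<integral>x. max 0 (h x - g n x) \<partial>M) \<le> (\<integral>x. k x - g n x \<partial>M)"
        using k hm g_int S(2)[OF k(1)] by (intro integral_mono_AE) (auto elim: eventually_mono)
      also have "\<dots> \<le> s - (s - 1 / Suc n)"
        using le_s[OF k(1)] g_lower[of n] S(2)[OF k(1)] g_int by simp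
      finally show ?thesis by simp
    qed
    \<comment> \<open>\<open>q\<close> is the positive part of \<open>h - G\<close>, written as an infimum so that each \<open>h - g n\<close> bounds its
      integral.\<close>
    define q where "q x = (INF n. ennreal (max 0 (h x - g n x)))" for x
    have [measurable]: "q \<in> borel_measurable M" unfolding q_def by measurable
    have "(\<integral>\<^sup>+x. q x \<partial>M) \<le> ennreal (1 / Suc n)" for n
    proof -
      have "(\<integral>\<^sup>+x. q x \<partial>M) \<le> (\<integral>\<^sup>+x. ennreal (max 0 (h x - g n x)) \<partial>M)"
        unfolding q_def by (intro nn_integral_mono INF_lower) simp
      also have "\<dots> = ennreal (\<integral>x. max 0 (h x - g n x) \<partial>M)"
        using hm g_int by (intro nn_integral_eq_integral) auto
      also have "\<dots> \<le> ennreal (1 / Suc n)" using excess by (rule ennreal_leI)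
      finally show ?thesis .
    qed
    moreover have "(\<lambda>n. ennreal (1 / Suc n)) \<longlonglongrightarrow> ennreal 0"
      by (intro tendsto_ennrealI LIMSEQ_Suc lim_1_over_n)
    ultimately have "(\<integral>\<^sup>+x. q x \<partial>M) = 0"
      using LIMSEQ_le_const[of "\<lambda>n. ennreal (1 / Suc n)" 0] by auto
    then have "AE x in M. q x = 0" by (subst (asm) nn_integral_0_iff_AE) auto
    then show ?thesis
    proof eventually_elim
      case (elim x)
      show ?case
      proof (rule ccontr)
        assume "\<not> ?thesis"
        then obtain r where r: "G x < ereal r" "ereal r < ereal (h x)"
          using ereal_dense2[of "G x" "ereal (h x)"] by (auto simp: not_le)
        have "ennreal (h x - r) \<le> q x" unfolding q_def
        proof (rule INF_greatest)
          fix n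
          have "ereal (g n x) \<le> G x" unfolding G_def by (rule SUP_upper) simp
          from this r(1) have "ereal (g n x) < ereal r" by (rule le_less_trans)
          then show "ennreal (h x - r) \<le> ennreal (max 0 (h x - g n x))" by (intro ennreal_leI) auto
        qed
        with elim r(2) show False by auto
      qed
    qed
  qed
  then have R_le_G: "AE x in M. ereal (R x) \<le> G x"
    using X G_meas unfolding is_ess_sup_def by blast
  have lim: "AE x in M. (\<lambda>n. g n x) \<longlonglongrightarrow> R x"
  proof -
    have "AE x in M. \<forall>n. g n x \<le> R x" "AE x in M. \<forall>n. g n x \<le> g (Suc n) x"
      using g_le_R g(3) by (auto simp: AE_all_countable)
    then show ?thesis using R_le_G
    proof eventually_elim
      case (elim x)
      have "incseq (\<lambda>n. ereal (g n x))" using elim by (intro incseq_SucI) auto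
      then have "(\<lambda>n. ereal (g n x)) \<longlonglongrightarrow> G x" unfolding G_def by (rule LIMSEQ_SUP)
      moreover have "G x \<le> ereal (R x)"
        using elim unfolding G_def by (intro SUP_least) auto
      then have "G x = ereal (R x)" using elim by auto
      ultimately show ?case by simp
    qed
  qed
  have "(\<lambda>n. \<integral>x. g n x \<partial>M) \<longlonglongrightarrow> (\<integral>x. R x \<partial>M)"
  proof (rule integral_dominated_convergence[where w = "\<lambda>x. \<bar>g 0 x\<bar> + \<bar>R x\<bar>"])
    fix n
    have mono0: "AE x in M. g 0 x \<le> g n x"
    proof (induction n)
      case (Suc n)
      then show ?case using g(3)[of n] by eventually_elim auto
    qed simp
    then show "AE x in M. norm (g n x) \<le> \<bar>g 0 x\<bar> + \<bar>R x\<bar>"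
      using g_le_R[of n] by eventually_elim auto
  qed (use R g_int lim in auto)
  then show ?thesis
    using le[OF g(1)] by (intro LIMSEQ_le_const2) auto
qed

section \<open>Separating one coordinate of a product of probability measures\<close>

text \<open>
  The coordinate \<open>i\<close> is the outer variable here, whereas \<open>product_integral_insert\<close> makes it the inner
  one. In the recursion the next maturity is fixed before the later ones are integrated.
\<close>
lemma
  fixes P :: "'i \<Rightarrow> 'b measure"
  assumes P: "\<And>j. j \<in> insert i I \<Longrightarrow> prob_space (P j)" and i: "i \<notin> I"
  shows AE_PiM_insert:
    "\<And>Q. AE w in PiM (insert i I) P. Q w \<Longrightarrow> AE z in P i. AE w in PiM I P. Q (w(i := z))"
    and AE_integrable_PiM_insert: "\<And>f :: _ \<Rightarrow> real. integrable (PiM (insert i I) P) f \<Longrightarrow>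
      AE z in P i. integrable (PiM I P) (\<lambda>w. f (w(i := z)))"
    and integrable_PiM_insert: "\<And>f :: _ \<Rightarrow> real. integrable (PiM (insert i I) P) f \<Longrightarrow>
      integrable (P i) (\<lambda>z. \<integral>w. f (w(i := z)) \<partial>PiM I P)"
    and integral_PiM_insert: "\<And>f :: _ \<Rightarrow> real. integrable (PiM (insert i I) P) f \<Longrightarrow>
      (\<integral>w. f w \<partial>PiM (insert i I) P) = (\<integral>z. (\<integral>w. f (w(i := z)) \<partial>PiM I P) \<partial>P i)"
proof -
  interpret Pi: prob_space "P i" by (rule P) simp
  interpret PI: prob_space "PiM I P" by (intro prob_space_PiM P) simp
  interpret pair_sigma_finite "P i" "PiM I P" ..
  have d: "PiM (insert i I) P = distr (P i \<Otimes>\<^sub>M PiM I P) (PiM (insert i I) P) (\<lambda>(z, w). w(i := z))"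
    using distr_pair_PiM_eq_PiM[of I P i] P by simp
  have upd[measurable]: "(\<lambda>(z, w). w(i := z)) \<in> P i \<Otimes>\<^sub>M PiM I P \<rightarrow>\<^sub>M PiM (insert i I) P"
    by measurable
  show "AE z in P i. AE w in PiM I P. Q (w(i := z))" if "AE w in PiM (insert i I) P. Q w" for Q
  proof -
    have "AE w in distr (P i \<Otimes>\<^sub>M PiM I P) (PiM (insert i I) P) (\<lambda>(z, w). w(i := z)). Q w"
      using that by (subst d[symmetric])
    from AE_pair[OF AE_distrD[OF upd this]] show ?thesis by simp
  qed
  fix f :: "_ \<Rightarrow> real" assume f: "integrable (PiM (insert i I) P) f"
  then have [measurable]: "f \<in> borel_measurable (PiM (insert i I) P)" by auto
  have "integrable (P i \<Otimes>\<^sub>M PiM I P) (\<lambda>(z, w). f (w(i := z)))"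
    using f by (subst (asm) d) (auto simp: integrable_distr_eq split_beta')
  note * = AE_integrable_fst'[OF this] integrable_fst'[OF this] integral_fst'[OF this]
  show "AE z in P i. integrable (PiM I P) (\<lambda>w. f (w(i := z)))"
    "integrable (P i) (\<lambda>z. \<integral>w. f (w(i := z)) \<partial>PiM I P)"
    using *(1,2) by auto
  have "(\<integral>w. f w \<partial>PiM (insert i I) P) = (\<integral>p. (case p of (z, w) \<Rightarrow> f (w(i := z))) \<partial>(P i \<Otimes>\<^sub>M PiM I P))"
    by (subst d, subst integral_distr) (auto simp: split_beta')
  then show "(\<integral>w. f w \<partial>PiM (insert i I) P) = (\<integral>z. (\<integral>w. f (w(i := z)) \<partial>PiM I P) \<partial>P i)"
    using *(3) by simp
qed

section \<open>The backward algorithm: measurability\<close>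

text \<open>
  The assumptions under which the recursion holds at every time and stage. What concerns time zero
  (triviality of \<open>F 0\<close>) or the maturities taken jointly is added where it is used.
\<close>
locale randomized_maturity_problem = prob_space M + filtration "space M" F
  for M :: "'w measure" and F :: "real \<Rightarrow> 'w measure" +
  fixes UF :: "(real \<Rightarrow> 'w \<Rightarrow> 'b) set"
    and Y :: "(real \<Rightarrow> 'w \<Rightarrow> 'b) \<Rightarrow> real \<Rightarrow> 'w \<Rightarrow> real"
    and MY :: "real \<Rightarrow> 'w \<Rightarrow> real"
    and n :: nat
    and \<zeta> :: "nat \<Rightarrow> 'w \<Rightarrow> real"
    and V :: "nat \<Rightarrow> (real \<Rightarrow> 'w \<Rightarrow> 'b) \<Rightarrow> real \<Rightarrow> 'w \<Rightarrow> ereal"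
    and Vbar :: "nat \<Rightarrow> (real \<Rightarrow> 'w \<Rightarrow> 'b) \<Rightarrow> real \<Rightarrow> 'w \<Rightarrow> real"
  assumes subalgebra_F: "t \<ge> 0 \<Longrightarrow> subalgebra M (F t)"
    and progressive: "\<nu> \<in> UF \<Longrightarrow> progressively_measurable F (Y \<nu>)"
    and local_Y: "local_in_control M F UF Y"
    and pasting: "stable_under_pasting M F UF"
    and maturities: "j \<in> {1..n} \<Longrightarrow> \<zeta> j \<in> randomized_maturities M F"
    and algorithm: "maturity_algorithm M F UF Y n \<zeta> V Vbar"
    and martingale_MY: "martingale M F MY"
    and Y_le_MY: "\<nu> \<in> UF \<Longrightarrow> AE \<omega> in M. \<forall>t\<ge>0. \<bar>Y \<nu> t \<omega>\<bar> \<le> MY t \<omega>"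
    and aggregation: "\<nu> \<in> UF \<Longrightarrow> k \<in> {1..n - 1} \<Longrightarrow> aggregates M F (Vbar k \<nu>) (V k \<nu>)"
begin

abbreviation F_inf :: "'w measure" where "F_inf \<equiv> F_infinity M F"

lemma space_F_inf: "space F_inf = space M"
  and sets_F_subset_F_inf: "t \<ge> 0 \<Longrightarrow> sets (F t) \<subseteq> sets F_inf"
  and subalgebra_F_inf: "subalgebra M F_inf"
proof -
  have sub: "(\<Union>t\<in>{0..}. sets (F t)) \<subseteq> Pow (space M)"
    using sets.sets_into_space[of _ "F _"] space_F by fastforce
  show sp: "space F_inf = space M"
    using sub by (simp add: F_infinity_def space_measure_of)
  have "sets F_inf = sigma_sets (space M) (\<Union>t\<in>{0..}. sets (F t))"
    using sub by (simp add: F_infinity_def sets_measure_of)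
  moreover have "(\<Union>t\<in>{0..}. sets (F t)) \<subseteq> sets M"
    using subalgebra_F by (auto simp: subalgebra_def)
  ultimately show "subalgebra M F_inf"
    using sp sets.sigma_sets_subset[of "\<Union>t\<in>{0..}. sets (F t)" M] by (simp add: subalgebra_def)
  show "sets (F t) \<subseteq> sets F_inf" if "t \<ge> 0"
    using that \<open>sets F_inf = _\<close> by auto
qed

lemma measurable_F_inf_D: "f \<in> F_inf \<rightarrow>\<^sub>M N \<Longrightarrow> f \<in> M \<rightarrow>\<^sub>M N"
  by (rule measurable_from_subalg[OF subalgebra_F_inf])

lemma measurable_pair_F_inf_D:
  assumes "f \<in> borel \<Otimes>\<^sub>M F_inf \<rightarrow>\<^sub>M N"
  shows "f \<in> borel \<Otimes>\<^sub>M M \<rightarrow>\<^sub>M N"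
proof -
  have [measurable]: "(\<lambda>\<omega>. \<omega>) \<in> M \<rightarrow>\<^sub>M F_inf"
    by (rule measurable_F_inf_D) simp
  have "(\<lambda>p. (fst p, snd p)) \<in> borel \<Otimes>\<^sub>M M \<rightarrow>\<^sub>M borel \<Otimes>\<^sub>M F_inf" by measurable
  from measurable_compose[OF this assms] show ?thesis by simp
qed

lemma Vbar_0: "\<nu> \<in> UF \<Longrightarrow> Vbar 0 \<nu> = Y \<nu>"
  and V_0: "\<nu> \<in> UF \<Longrightarrow> V 0 \<nu> = (\<lambda>t \<omega>. ereal (Y \<nu> t \<omega>))"
  using algorithm by (auto simp: maturity_algorithm_def)

text \<open>
  Progressive measurability concerns one bounded time interval at a time; the process is the
  pointwise limit of its versions stopped at \<open>i\<close>. Times are truncated by \<open>max 0\<close> so that joint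
  measurability can be used on all of \<^typ>\<open>real\<close>.
\<close>
lemma progressive_jointly_measurable:
  assumes X: "progressively_measurable F X"
  shows "(\<lambda>p. X (max 0 (fst p)) (snd p)) \<in> borel_measurable (borel \<Otimes>\<^sub>M F_inf)"
proof (rule borel_measurable_LIMSEQ_real)
  fix p :: "real \<times> 'w"
  obtain N :: nat where N: "max 0 (fst p) \<le> N" using real_arch_simple by blast
  have "eventually (\<lambda>i. X (min (real i) (max 0 (fst p))) (snd p) = X (max 0 (fst p)) (snd p)) sequentially"
    using eventually_ge_at_top[of N]
  proof eventually_elim
    case (elim i)
    with N have "min (real i) (max 0 (fst p)) = max 0 (fst p)" by linarith
    then show ?case by simp
  qed
  then show "(\<lambda>i. X (min (real i) (max 0 (fst p))) (snd p)) \<longlonglongrightarrow> X (max 0 (fst p)) (snd p)"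
    by (rule tendsto_eventually)
next
  fix i :: nat
  have [measurable]: "(\<lambda>\<omega>. \<omega>) \<in> F_inf \<rightarrow>\<^sub>M F (real i)"
    using sets_F_subset_F_inf[of "real i"] space_F_inf space_F[of "real i"]
      sets.sets_into_space[of _ "F (real i)"]
    by (intro measurableI) (auto simp: Int_absorb2)
  have [measurable]: "(\<lambda>x::real. min (real i) (max 0 x)) \<in> borel \<rightarrow>\<^sub>M restrict_space borel {0..real i}"
    by (intro measurable_restrict_space2) auto
  have "(\<lambda>p. (min (real i) (max 0 (fst p)), snd p))
      \<in> borel \<Otimes>\<^sub>M F_inf \<rightarrow>\<^sub>M restrict_space borel {0..real i} \<Otimes>\<^sub>M F (real i)"
    by measurable
  moreover have "(\<lambda>(s, \<omega>). X s \<omega>) \<in> borel_measurable (restrict_space borel {0..real i} \<Otimes>\<^sub>M F (real i))"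
    using X by (simp add: progressively_measurable_def)
  ultimately show "(\<lambda>p. X (min (real i) (max 0 (fst p))) (snd p)) \<in> borel_measurable (borel \<Otimes>\<^sub>M F_inf)"
    using measurable_compose[of "\<lambda>p. (min (real i) (max 0 (fst p)), snd p)" _ _ "\<lambda>(s, \<omega>). X s \<omega>"] by auto
qed

lemma Vbar_jointly_measurable:
  assumes "k < n" "\<nu> \<in> UF"
  shows "(\<lambda>p. Vbar k \<nu> (max 0 (fst p)) (snd p)) \<in> borel_measurable (borel \<Otimes>\<^sub>M F_inf)"
proof (cases "k = 0")
  case True
  then show ?thesis
    using progressive_jointly_measurable[OF progressive[OF assms(2)]] by (simp add: Vbar_0 assms(2))
next
  case False
  then have "(\<lambda>(\<omega>, t). Vbar k \<nu> t \<omega>) \<in> borel_measurable (F_inf \<Otimes>\<^sub>M restrict_space borel {0..})"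
    using aggregation[OF assms(2), of k] assms(1) by (auto simp: aggregates_def)
  moreover have "(\<lambda>p. max 0 (fst p)) \<in> borel \<Otimes>\<^sub>M F_inf \<rightarrow>\<^sub>M restrict_space borel {0::real..}"
    by (intro measurable_restrict_space2) auto
  then have "(\<lambda>p. (snd p, max 0 (fst p))) \<in> borel \<Otimes>\<^sub>M F_inf \<rightarrow>\<^sub>M F_inf \<Otimes>\<^sub>M restrict_space borel {0::real..}"
    by (rule measurable_Pair[OF measurable_snd])
  ultimately show ?thesis
    using measurable_compose[of "\<lambda>p. (snd p, max 0 (fst p))" _ _ "\<lambda>(\<omega>, t). Vbar k \<nu> t \<omega>"] by auto
qed

lemma Vbar_shift_measurable:
  assumes "k < n" "\<nu> \<in> UF" "0 \<le> t"
  shows "(\<lambda>p. Vbar k \<nu> (t + max 0 (fst p)) (snd p)) \<in> borel_measurable (borel \<Otimes>\<^sub>M F_inf)"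
proof -
  have "(\<lambda>p. (t + max 0 (fst p), snd p)) \<in> borel \<Otimes>\<^sub>M F_inf \<rightarrow>\<^sub>M borel \<Otimes>\<^sub>M F_inf" by measurable
  from measurable_compose[OF this Vbar_jointly_measurable[OF assms(1,2)]] show ?thesis
    using assms(3) by (simp add: max_def add_nonneg_nonneg cong: if_cong)
qed

lemma Vbar_measurable:
  assumes "k < n" "\<nu> \<in> UF" "0 \<le> t"
  shows "Vbar k \<nu> t \<in> borel_measurable M"
proof -
  have "(\<lambda>\<omega>. (0, \<omega>)) \<in> M \<rightarrow>\<^sub>M borel \<Otimes>\<^sub>M M" by measurable
  from measurable_compose[OF this measurable_pair_F_inf_D[OF Vbar_shift_measurable[OF assms]]]
  show ?thesis by simp
qed

lemma AE_Vbar_eq_V: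
  assumes "k < n" "\<nu> \<in> UF" "0 \<le> t"
  shows "AE \<omega> in M. ereal (Vbar k \<nu> t \<omega>) = V k \<nu> t \<omega>"
  using assms aggregation[OF assms(2), of k]
  by (cases "k = 0") (auto simp: Vbar_0 V_0 aggregates_def)

abbreviation law :: "nat \<Rightarrow> real measure" where "law j \<equiv> distr M borel (\<zeta> j)"

lemma
  assumes "j \<in> {1..n}"
  shows maturity_independent: "independent_of M borel (\<zeta> j) F_inf"
    and maturity_measurable: "\<zeta> j \<in> borel_measurable M"
    and maturity_nonneg: "\<omega> \<in> space M \<Longrightarrow> 0 \<le> \<zeta> j \<omega>"
    and prob_space_law: "prob_space (law j)"
    and AE_law_nonneg: "AE z in law j. 0 \<le> z"
proof -
  show ind: "independent_of M borel (\<zeta> j) F_inf" and nn: "\<omega> \<in> space M \<Longrightarrow> 0 \<le> \<zeta> j \<omega>" for \<omega>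
    using maturities[OF assms] by (auto simp: randomized_maturities_def)
  then show "\<zeta> j \<in> borel_measurable M" by (auto simp: independent_of_def)
  then show "prob_space (law j)" "AE z in law j. 0 \<le> z"
    using nn by (auto intro: prob_space_distr simp: AE_distr_iff)
qed

section \<open>Domination by the martingale\<close>

lemma finite_measure_subalgebra_F: "0 \<le> t \<Longrightarrow> finite_measure_subalgebra M (F t)"
  by (intro finite_measure_subalgebra.intro finite_measure_axioms
      finite_measure_subalgebra_axioms.intro subalgebra_F)

lemma sigma_finite_subalgebra_F: "0 \<le> t \<Longrightarrow> sigma_finite_subalgebra M (F t)"
  by (intro finite_measure_subalgebra_is_sigma_finite finite_measure_subalgebra_F)

lemma MY_measurable: "0 \<le> t \<Longrightarrow> MY t \<in> borel_measurable (F t)"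
  and MY_integrable: "0 \<le> t \<Longrightarrow> integrable M (MY t)"
  using martingale_MY by (auto simp: martingale_def adapted_def)

lemma sets_F_D: "0 \<le> t \<Longrightarrow> A \<in> sets (F t) \<Longrightarrow> A \<in> sets M"
  using subalgebra_F by (auto simp: subalgebra_def)

lemma integral_MY_shift:
  assumes "0 \<le> t" "t \<le> s" "A \<in> sets (F t)"
  shows "(\<integral>\<omega>\<in>A. MY s \<omega> \<partial>M) = (\<integral>\<omega>\<in>A. MY t \<omega> \<partial>M)"
proof -
  interpret sigma_finite_subalgebra M "F t" using assms(1) by (rule sigma_finite_subalgebra_F)
  have [measurable]: "A \<in> sets M" using assms sets_F_D by blast
  have ms: "MY t \<in> borel_measurable M" using MY_integrable assms by auto
  have eq: "AE \<omega> in M. real_cond_exp M (F t) (MY s) \<omega> = MY t \<omega>"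
    using martingale_MY assms by (auto simp: martingale_def)
  have "(\<integral>\<omega>\<in>A. MY s \<omega> \<partial>M) = (\<integral>\<omega>\<in>A. real_cond_exp M (F t) (MY s) \<omega> \<partial>M)"
    using MY_integrable assms by (intro real_cond_exp_intA) auto
  also have "\<dots> = (\<integral>\<omega>\<in>A. MY t \<omega> \<partial>M)"
    using ms eq by (intro set_lebesgue_integral_cong_AE) (auto elim: eventually_mono)
  finally show ?thesis .
qed

lemma expectation_MY: "0 \<le> t \<Longrightarrow> expectation (MY t) = expectation (MY 0)"
  using integral_MY_shift[of 0 t "space M"] sets.top[of "F 0"] space_F[of 0]
  by (simp add: set_integral_space MY_integrable)

text \<open>The value of stage \<open>k\<close>, seen from \<open>t\<close>, at the maturity that stage \<open>k + 1\<close> is about to add.\<close>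
definition delayed :: "nat \<Rightarrow> (real \<Rightarrow> 'w \<Rightarrow> 'b) \<Rightarrow> real \<Rightarrow> 'w \<Rightarrow> real" where
  "delayed k \<mu> t = (\<lambda>\<omega>. Vbar k \<mu> (t + \<zeta> (n - k) \<omega>) \<omega>)"

definition continuation :: "nat \<Rightarrow> (real \<Rightarrow> 'w \<Rightarrow> 'b) \<Rightarrow> real \<Rightarrow> 'w \<Rightarrow> real" where
  "continuation k \<mu> t = real_cond_exp M (F t) (delayed k \<mu> t)"

lemma V_Suc_is_ess_sup:
  assumes "k < n" "\<nu> \<in> UF" "0 \<le> t"
  shows "is_ess_sup M ((\<lambda>\<mu> \<omega>. ereal (continuation k \<mu> t \<omega>)) ` controls_from M UF t \<nu>) (V (Suc k) \<nu> t)"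
  using algorithm assms by (auto simp: maturity_algorithm_def continuation_def delayed_def)

lemma continuation_le_V:
  assumes "k < n" "\<nu> \<in> UF" "0 \<le> t" "\<mu> \<in> controls_from M UF t \<nu>"
  shows "AE \<omega> in M. ereal (continuation k \<mu> t \<omega>) \<le> V (Suc k) \<nu> t \<omega>"
  using V_Suc_is_ess_sup[OF assms(1-3)] assms(4) by (auto simp: is_ess_sup_def)

lemma V_least:
  assumes "k < n" "\<nu> \<in> UF" "0 \<le> t" "X \<in> borel_measurable M"
    and "\<And>\<mu>. \<mu> \<in> controls_from M UF t \<nu> \<Longrightarrow> AE \<omega> in M. ereal (continuation k \<mu> t \<omega>) \<le> X \<omega>"
  shows "AE \<omega> in M. V (Suc k) \<nu> t \<omega> \<le> X \<omega>"
  using V_Suc_is_ess_sup[OF assms(1-3)] assms(4,5) by (auto simp: is_ess_sup_def)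

lemma V_measurable:
  assumes "k \<le> n" "\<nu> \<in> UF" "0 \<le> t"
  shows "V k \<nu> t \<in> borel_measurable M"
proof (cases k)
  case 0
  then have "V k \<nu> t = (\<lambda>\<omega>. ereal (Y \<nu> t \<omega>))" using V_0 assms by simp
  moreover have "Y \<nu> t \<in> borel_measurable M"
  proof -
    have "(\<lambda>\<omega>. (t, \<omega>)) \<in> M \<rightarrow>\<^sub>M borel \<Otimes>\<^sub>M M" by measurable
    from measurable_compose[OF this
        measurable_pair_F_inf_D[OF progressive_jointly_measurable[OF progressive[OF assms(2)]]]]
    show ?thesis using assms(3) by simp
  qed
  ultimately show ?thesis by simp
next
  case (Suc j)
  with V_Suc_is_ess_sup[of j \<nu> t] assms show ?thesis by (auto simp: is_ess_sup_def)
qed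

lemma self_in_controls_from: "\<nu> \<in> UF \<Longrightarrow> \<nu> \<in> controls_from M UF t \<nu>"
  by (simp add: controls_from_def agree_before_def)

lemma delayed_eq:
  assumes "k < n" "\<omega> \<in> space M"
  shows "delayed k \<mu> t \<omega> = Vbar k \<mu> (t + max 0 (\<zeta> (n - k) \<omega>)) \<omega>"
  using maturity_nonneg[of "n - k"] assms by (simp add: delayed_def)

text \<open>
  The domination of stage \<open>k\<close> is a hypothesis because \<open>dominated_continuation\<close> serves as the induction
  step for it. In the last claim the martingale, which need not be jointly measurable, is evaluated
  at deterministic times only: by Fubini, \<open>E[1\<^sub>A Vbar(t + \<zeta>)]\<close> is an average of \<open>E[1\<^sub>A Vbar(t + z)] \<le> E[1\<^sub>A MY(t + z)] = E[1\<^sub>A MY(t)]\<close>.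
\<close>
lemma
  assumes k: "k < n" and \<mu>: "\<mu> \<in> UF" and t: "0 \<le> t"
    and dom: "\<And>s. 0 \<le> s \<Longrightarrow> AE \<omega> in M. \<bar>Vbar k \<mu> s \<omega>\<bar> \<le> MY s \<omega>"
  shows dominated_delayed_integrable: "integrable M (delayed k \<mu> t)"
    and dominated_expectation_delayed: "expectation (delayed k \<mu> t)
      = (\<integral>z. expectation (Vbar k \<mu> (t + max 0 z)) \<partial>law (n - k))"
    and dominated_expectation_integrable:
      "integrable (law (n - k)) (\<lambda>z. expectation (Vbar k \<mu> (t + max 0 z)))"
    and dominated_continuation: "AE \<omega> in M. \<bar>continuation k \<mu> t \<omega>\<bar> \<le> MY t \<omega>"
proof -
  have j: "n - k \<in> {1..n}" using k by auto
  interpret prob_law: prob_space "law (n - k)" using j by (rule prob_space_law)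
  interpret Ft: sigma_finite_subalgebra M "F t" using t by (rule sigma_finite_subalgebra_F)
  have Vm: "(\<lambda>\<omega>. Vbar k \<mu> s \<omega>) \<in> borel_measurable M" if "0 \<le> s" for s
    using Vbar_measurable[OF k \<mu> that] .
  have V_int: "integrable M (Vbar k \<mu> s)" and V_abs: "(\<integral>\<omega>. \<bar>Vbar k \<mu> s \<omega>\<bar> \<partial>M) \<le> expectation (MY 0)"
    if "0 \<le> s" for s
  proof -
    show int: "integrable M (Vbar k \<mu> s)"
      using dom[OF that] Vm[OF that]
      by (intro Bochner_Integration.integrable_bound[OF MY_integrable[OF that]]) (auto elim: eventually_mono)
    have "(\<integral>\<omega>. \<bar>Vbar k \<mu> s \<omega>\<bar> \<partial>M) \<le> expectation (MY s)"
      using int MY_integrable[OF that] dom[OF that] by (intro integral_mono_AE) auto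
    then show "(\<integral>\<omega>. \<bar>Vbar k \<mu> s \<omega>\<bar> \<partial>M) \<le> expectation (MY 0)"
      using expectation_MY[OF that] by simp
  qed
  \<comment> \<open>The indicator serves the test events of the conditional expectation, and \<open>c\<close> with values \<open>1\<close> and
    \<open>-1\<close> gives the bound from both sides.\<close>
  define f where "f A c p = c * (indicator A (snd p) * Vbar k \<mu> (t + max 0 (fst p)) (snd p))"
    for A and c :: real and p :: "real \<times> 'w"
  have Fub: "integrable M (\<lambda>\<omega>. f A c (\<zeta> (n - k) \<omega>, \<omega>))"
      "(\<integral>\<omega>. f A c (\<zeta> (n - k) \<omega>, \<omega>) \<partial>M) = (\<integral>z. (\<integral>\<omega>. f A c (z, \<omega>) \<partial>M) \<partial>law (n - k))"
      "integrable (law (n - k)) (\<lambda>z. \<integral>\<omega>. f A c (z, \<omega>) \<partial>M)"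
    if A: "A \<in> sets F_inf" and c: "\<bar>c\<bar> \<le> 1" for A c
  proof -
    have AM: "A \<in> sets M" using A subalgebra_F_inf by (auto simp: subalgebra_def)
    note A[measurable] Vbar_shift_measurable[OF k \<mu> t, measurable]
    have fm: "f A c \<in> borel_measurable (borel \<Otimes>\<^sub>M F_inf)" unfolding f_def by measurable
    have "integrable M (\<lambda>\<omega>. f A c (z, \<omega>)) \<and> (\<integral>\<omega>. \<bar>f A c (z, \<omega>)\<bar> \<partial>M) \<le> expectation (MY 0)" for z
    proof -
      have s: "0 \<le> t + max 0 z" using t by simp
      have int: "integrable M (\<lambda>\<omega>. f A c (z, \<omega>))"
        using integrable_mult_indicator[OF AM V_int[OF s]] by (simp add: f_def)
      have "\<bar>f A c (z, \<omega>)\<bar> \<le> \<bar>Vbar k \<mu> (t + max 0 z) \<omega>\<bar>" for \<omega>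
        using c mult_right_mono[of "\<bar>c\<bar>" 1 "\<bar>Vbar k \<mu> (t + max 0 z) \<omega>\<bar>"]
        by (auto simp: f_def indicator_def abs_mult)
      then have "(\<integral>\<omega>. \<bar>f A c (z, \<omega>)\<bar> \<partial>M) \<le> (\<integral>\<omega>. \<bar>Vbar k \<mu> (t + max 0 z) \<omega>\<bar> \<partial>M)"
        using int V_int[OF s] by (intro integral_mono) auto
      with V_abs[OF s] int show ?thesis by simp
    qed
    then have "AE z in law (n - k). integrable M (\<lambda>\<omega>. f A c (z, \<omega>)) \<and>
        (\<integral>\<omega>. \<bar>f A c (z, \<omega>)\<bar> \<partial>M) \<le> expectation (MY 0)" by simp
    note * = integrable_at_independent[OF maturity_independent[OF j] subalgebra_F_inf fm this]
      integral_at_independent[OF maturity_independent[OF j] subalgebra_F_inf fm this]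
      integrable_section_integral[OF maturity_independent[OF j] subalgebra_F_inf fm this]
    from * show "integrable M (\<lambda>\<omega>. f A c (\<zeta> (n - k) \<omega>, \<omega>))"
      "(\<integral>\<omega>. f A c (\<zeta> (n - k) \<omega>, \<omega>) \<partial>M) = (\<integral>z. (\<integral>\<omega>. f A c (z, \<omega>) \<partial>M) \<partial>law (n - k))"
      "integrable (law (n - k)) (\<lambda>z. \<integral>\<omega>. f A c (z, \<omega>) \<partial>M)" by simp_all
  qed
  have f_del: "f A c (\<zeta> (n - k) \<omega>, \<omega>) = indicator A \<omega> * (c * delayed k \<mu> t \<omega>)" if "\<omega> \<in> space M" for A c \<omega>
    using delayed_eq[OF k that] by (simp add: f_def)
  have sp: "space M \<in> sets F_inf" using sets.top[of F_inf] by (simp add: space_F_inf)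
  have f_sp: "f (space M) 1 (z, \<omega>) = Vbar k \<mu> (t + max 0 z) \<omega>" if "\<omega> \<in> space M" for z \<omega>
    using that by (simp add: f_def)
  have sp_int: "(\<integral>\<omega>. f (space M) 1 (z, \<omega>) \<partial>M) = expectation (Vbar k \<mu> (t + max 0 z))" for z
    by (rule Bochner_Integration.integral_cong) (auto simp: f_sp)
  have "integrable M (\<lambda>\<omega>. f (space M) 1 (\<zeta> (n - k) \<omega>, \<omega>)) = integrable M (delayed k \<mu> t)"
    by (rule Bochner_Integration.integrable_cong) (auto simp: f_del)
  then show del_int: "integrable M (delayed k \<mu> t)" using Fub(1)[OF sp] by simp
  have "(\<integral>\<omega>. f (space M) 1 (\<zeta> (n - k) \<omega>, \<omega>) \<partial>M) = expectation (delayed k \<mu> t)"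
    by (rule Bochner_Integration.integral_cong) (auto simp: f_del)
  then show "expectation (delayed k \<mu> t) = (\<integral>z. expectation (Vbar k \<mu> (t + max 0 z)) \<partial>law (n - k))"
    using Fub(2)[OF sp, of 1] by (simp add: sp_int)
  show "integrable (law (n - k)) (\<lambda>z. expectation (Vbar k \<mu> (t + max 0 z)))"
    using Fub(3)[OF sp, of 1] by (simp add: sp_int)
  have bound: "AE \<omega> in M. real_cond_exp M (F t) (\<lambda>\<omega>. c * delayed k \<mu> t \<omega>) \<omega> \<le> MY t \<omega>"
    if c: "\<bar>c\<bar> \<le> 1" for c
  proof (rule Ft.real_cond_exp_le)
    show "integrable M (\<lambda>\<omega>. c * delayed k \<mu> t \<omega>)" using del_int by simp
    show "integrable M (MY t)" "MY t \<in> borel_measurable (F t)"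
      using MY_integrable MY_measurable t by auto
    fix A assume A: "A \<in> sets (F t)"
    then have AM: "A \<in> sets M" and AF: "A \<in> sets F_inf"
      using sets_F_D sets_F_subset_F_inf t by blast+
    have "(\<integral>\<omega>\<in>A. c * delayed k \<mu> t \<omega> \<partial>M) = (\<integral>\<omega>. f A c (\<zeta> (n - k) \<omega>, \<omega>) \<partial>M)"
      unfolding set_lebesgue_integral_def
      by (rule Bochner_Integration.integral_cong) (auto simp: f_del)
    also have "\<dots> = (\<integral>z. (\<integral>\<omega>. f A c (z, \<omega>) \<partial>M) \<partial>law (n - k))" by (rule Fub(2)[OF AF c])
    also have "\<dots> \<le> (\<integral>z. (\<integral>\<omega>\<in>A. MY t \<omega> \<partial>M) \<partial>law (n - k))"
    proof (rule integral_mono[OF Fub(3)[OF AF c]])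
      fix z
      have s: "0 \<le> t + max 0 z" using t by simp
      have "(\<integral>\<omega>. f A c (z, \<omega>) \<partial>M) \<le> (\<integral>\<omega>\<in>A. MY (t + max 0 z) \<omega> \<partial>M)"
        unfolding set_lebesgue_integral_def
      proof (rule integral_mono_AE)
        show "integrable M (\<lambda>\<omega>. f A c (z, \<omega>))"
          using integrable_mult_indicator[OF AM V_int[OF s]] by (simp add: f_def)
        show "integrable M (\<lambda>\<omega>. indicator A \<omega> *\<^sub>R MY (t + max 0 z) \<omega>)"
          using integrable_mult_indicator[OF AM MY_integrable[OF s]] .
        show "AE \<omega> in M. f A c (z, \<omega>) \<le> indicator A \<omega> *\<^sub>R MY (t + max 0 z) \<omega>"
          using dom[OF s]
        proof eventually_elim
          case (elim \<omega>)
          have "c * Vbar k \<mu> (t + max 0 z) \<omega> \<le> \<bar>c\<bar> * \<bar>Vbar k \<mu> (t + max 0 z) \<omega>\<bar>"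
            by (simp add: abs_mult[symmetric])
          also have "\<dots> \<le> 1 * \<bar>Vbar k \<mu> (t + max 0 z) \<omega>\<bar>" using c by (intro mult_right_mono) auto
          finally show ?case using elim by (auto simp: f_def indicator_def)
        qed
      qed
      then show "(\<integral>\<omega>. f A c (z, \<omega>) \<partial>M) \<le> (\<integral>\<omega>\<in>A. MY t \<omega> \<partial>M)"
        using integral_MY_shift[OF t _ A, of "t + max 0 z"] by simp
    qed simp
    also have "\<dots> = (\<integral>\<omega>\<in>A. MY t \<omega> \<partial>M)" using prob_law.prob_space by simp
    finally show "(\<integral>\<omega>\<in>A. c * delayed k \<mu> t \<omega> \<partial>M) \<le> (\<integral>\<omega>\<in>A. MY t \<omega> \<partial>M)" .
  qed
  have "AE \<omega> in M. real_cond_exp M (F t) (\<lambda>\<omega>. (-1) * delayed k \<mu> t \<omega>) \<omega> = (-1) * continuation k \<mu> t \<omega>"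
    unfolding continuation_def using del_int by (rule Ft.real_cond_exp_cmult)
  then show "AE \<omega> in M. \<bar>continuation k \<mu> t \<omega>\<bar> \<le> MY t \<omega>"
    using bound[of 1, simplified] bound[of "-1", simplified]
    by eventually_elim (auto simp: continuation_def)
qed

text \<open>
  The essential supremum stays below \<open>MY\<close> by its minimality, and above \<open>-MY\<close> because it dominates the
  continuation value of \<open>\<nu>\<close> itself.
\<close>
lemma V_dominated:
  assumes "k \<le> n" "\<nu> \<in> UF" "0 \<le> t"
  shows "AE \<omega> in M. \<bar>V k \<nu> t \<omega>\<bar> \<le> ereal (MY t \<omega>)"
  using assms
proof (induction k arbitrary: \<nu> t)
  case 0
  then show ?case using Y_le_MY[of \<nu>] by (auto simp: V_0 elim: eventually_mono)
next
  case (Suc k)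
  then have k: "k < n" by simp
  have dom: "AE \<omega> in M. \<bar>Vbar k \<mu> s \<omega>\<bar> \<le> MY s \<omega>" if "\<mu> \<in> UF" "0 \<le> s" for \<mu> s
    using Suc.IH[OF less_imp_le[OF k] that] AE_Vbar_eq_V[OF k that]
    by eventually_elim (metis abs_ereal.simps(1) ereal_less_eq(3))
  have cont: "AE \<omega> in M. \<bar>continuation k \<mu> t \<omega>\<bar> \<le> MY t \<omega>" if "\<mu> \<in> UF" for \<mu>
    using dominated_continuation[OF k that Suc.prems(3) dom[OF that]] .
  have up: "AE \<omega> in M. V (Suc k) \<nu> t \<omega> \<le> ereal (MY t \<omega>)"
  proof (rule V_least[OF k Suc.prems(2,3)])
    show "(\<lambda>\<omega>. ereal (MY t \<omega>)) \<in> borel_measurable M"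
      using borel_measurable_integrable[OF MY_integrable[OF Suc.prems(3)]] by simp
    fix \<mu> assume "\<mu> \<in> controls_from M UF t \<nu>"
    then show "AE \<omega> in M. ereal (continuation k \<mu> t \<omega>) \<le> ereal (MY t \<omega>)"
      using cont[of \<mu>] by (auto simp: controls_from_def elim: eventually_mono)
  qed
  have "AE \<omega> in M. ereal (continuation k \<nu> t \<omega>) \<le> V (Suc k) \<nu> t \<omega>"
    using Suc.prems k self_in_controls_from by (intro continuation_le_V) auto
  with up cont[OF Suc.prems(2)] show ?case
  proof eventually_elim
    case (elim \<omega>)
    then show ?case by (cases "V (Suc k) \<nu> t \<omega>") auto
  qed
qed

lemma Vbar_dominated:
  assumes "k < n" "\<nu> \<in> UF" "0 \<le> t"
  shows "AE \<omega> in M. \<bar>Vbar k \<nu> t \<omega>\<bar> \<le> MY t \<omega>"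
  using V_dominated[OF less_imp_le[OF assms(1)] assms(2,3)] AE_Vbar_eq_V[OF assms]
  by eventually_elim (metis abs_ereal.simps(1) ereal_less_eq(3))

lemma
  assumes "k < n" "\<mu> \<in> UF" "0 \<le> t"
  shows delayed_integrable: "integrable M (delayed k \<mu> t)"
    and expectation_delayed: "expectation (delayed k \<mu> t)
      = (\<integral>z. expectation (Vbar k \<mu> (t + max 0 z)) \<partial>law (n - k))"
    and expectation_Vbar_integrable:
      "integrable (law (n - k)) (\<lambda>z. expectation (Vbar k \<mu> (t + max 0 z)))"
    and continuation_dominated: "AE \<omega> in M. \<bar>continuation k \<mu> t \<omega>\<bar> \<le> MY t \<omega>"
  using dominated_delayed_integrable dominated_expectation_delayed dominated_expectation_integrable
    dominated_continuation Vbar_dominated[OF assms(1,2)] assms by blast+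

section \<open>Locality of the values and directed continuations\<close>

text \<open>
  Equality on \<open>A\<close> at each fixed time carries over to the independent random time, and the indicator of
  \<open>A\<close> may be moved through the conditional expectation.
\<close>
lemma continuation_local:
  assumes k: "k < n" and \<mu>: "\<mu> \<in> UF" "\<mu>' \<in> UF" and s: "0 \<le> s" and A: "A \<in> sets (F s)"
    and eq: "\<And>r. s \<le> r \<Longrightarrow> AE \<omega> in M. \<omega> \<in> A \<longrightarrow> V k \<mu> r \<omega> = V k \<mu>' r \<omega>"
  shows "AE \<omega> in M. \<omega> \<in> A \<longrightarrow> continuation k \<mu> s \<omega> = continuation k \<mu>' s \<omega>"
proof -
  interpret Fs: sigma_finite_subalgebra M "F s" using s by (rule sigma_finite_subalgebra_F)
  have j: "n - k \<in> {1..n}" using k by auto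
  have AM[measurable]: "A \<in> sets M" and AF[measurable]: "A \<in> sets F_inf"
    using sets_F_D sets_F_subset_F_inf s A by blast+
  note Vbar_shift_measurable[OF k \<mu>(1) s, measurable] Vbar_shift_measurable[OF k \<mu>(2) s, measurable]
  define P where "P p \<longleftrightarrow> (snd p \<in> A \<longrightarrow>
      Vbar k \<mu> (s + max 0 (fst p)) (snd p) = Vbar k \<mu>' (s + max 0 (fst p)) (snd p))" for p :: "real \<times> 'w"
  have "AE \<omega> in M. P (\<zeta> (n - k) \<omega>, \<omega>)"
  proof (rule AE_at_independent[OF maturity_independent[OF j] subalgebra_F_inf])
    show "{p \<in> space (borel \<Otimes>\<^sub>M F_inf). P p} \<in> sets (borel \<Otimes>\<^sub>M F_inf)"
      unfolding P_def by measurable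
    have "AE \<omega> in M. P (z, \<omega>)" for z
    proof -
      have r: "0 \<le> s + max 0 z" using s by simp
      show ?thesis
        using eq[of "s + max 0 z", simplified] AE_Vbar_eq_V[OF k \<mu>(1) r] AE_Vbar_eq_V[OF k \<mu>(2) r]
        unfolding P_def by eventually_elim (metis ereal.inject fst_conv snd_conv)
    qed
    then show "AE z in law (n - k). AE \<omega> in M. P (z, \<omega>)" by simp
  qed
  then have eq_del: "AE \<omega> in M. indicator A \<omega> * delayed k \<mu> s \<omega> = (indicator A \<omega> * delayed k \<mu>' s \<omega> :: real)"
    using AE_space by eventually_elim (auto simp: P_def delayed_eq[OF k] indicator_def)
  have int: "integrable M (delayed k \<mu> s)" "integrable M (delayed k \<mu>' s)"
    using delayed_integrable k \<mu> s by auto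
  have m: "(indicator A :: 'w \<Rightarrow> real) \<in> borel_measurable (F s)" using A by simp
  have int': "integrable M (\<lambda>\<omega>. indicator A \<omega> * delayed k \<mu> s \<omega>)"
    "integrable M (\<lambda>\<omega>. indicator A \<omega> * delayed k \<mu>' s \<omega>)"
    using integrable_mult_indicator[OF AM int(1)] integrable_mult_indicator[OF AM int(2)] by simp_all
  have "AE \<omega> in M. real_cond_exp M (F s) (\<lambda>\<omega>. indicator A \<omega> * delayed k \<mu> s \<omega>) \<omega>
      = real_cond_exp M (F s) (\<lambda>\<omega>. indicator A \<omega> * delayed k \<mu>' s \<omega>) \<omega>"
    using eq_del int' by (intro Fs.real_cond_exp_cong) auto
  moreover have "AE \<omega> in M. real_cond_exp M (F s) (\<lambda>\<omega>. indicator A \<omega> * delayed k \<mu> s \<omega>) \<omega>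
      = indicator A \<omega> * continuation k \<mu> s \<omega>"
    unfolding continuation_def using m int int' by (intro Fs.real_cond_exp_mult) auto
  moreover have "AE \<omega> in M. real_cond_exp M (F s) (\<lambda>\<omega>. indicator A \<omega> * delayed k \<mu>' s \<omega>) \<omega>
      = indicator A \<omega> * continuation k \<mu>' s \<omega>"
    unfolding continuation_def using m int int' by (intro Fs.real_cond_exp_mult) auto
  ultimately show ?thesis by eventually_elim auto
qed

lemma sets_F_mono': "A \<in> sets (F t) \<Longrightarrow> t \<le> s \<Longrightarrow> A \<in> sets (F s)"
  using sets_F_mono by blast

lemma pasteI:
  assumes "\<nu>1 \<in> UF" "\<nu>2 \<in> UF" "0 \<le> t" "A \<in> sets (F t)" "agree_before M t \<nu>1 \<nu>2"
  shows "paste A \<nu>1 \<nu>2 \<in> UF"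
  using pasting assms by (auto simp: stable_under_pasting_def)

text \<open>
  Locality of \<open>Y\<close> propagates to every stage. The controls are assumed equal pointwise on \<open>A\<close>, which
  covers a pasted control on both sides of the pasting: \<open>paste A \<nu>1 \<nu>2\<close> coincides with \<open>\<nu>1\<close> on
  \<open>A\<close> and with \<open>\<nu>2\<close> off \<open>A\<close>.
  The event \<open>A\<close> belongs to \<open>F t\<close> with \<open>t\<close> possibly smaller than the time \<open>s\<close> of evaluation. This is
  needed for the induction: the pasted controls need not agree between \<open>t\<close> and \<open>s\<close> off \<open>A\<close>.
\<close>
lemma V_local:
  assumes "k \<le> n" "\<nu>1 \<in> UF" "\<nu>2 \<in> UF" "0 \<le> t" "A \<in> sets (F t)" "agree_before M t \<nu>1 \<nu>2"
    "\<And>\<omega> r. \<omega> \<in> A \<Longrightarrow> \<nu>1 r \<omega> = \<nu>2 r \<omega>" "t \<le> s"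
  shows "AE \<omega> in M. \<omega> \<in> A \<longrightarrow> V k \<nu>1 s \<omega> = V k \<nu>2 s \<omega>"
  using assms
proof (induction k arbitrary: \<nu>1 \<nu>2 s)
  case 0
  have "paste A \<nu>1 \<nu>2 = \<nu>2"
    using 0 by (auto simp: paste_def fun_eq_iff)
  moreover have "AE \<omega> in M. Y (paste A \<nu>1 \<nu>2) s \<omega> = paste A (Y \<nu>1) (Y \<nu>2) s \<omega>"
    using local_Y 0 unfolding local_in_control_def by blast
  ultimately show ?case
    using 0 by (auto simp: V_0 paste_def elim: eventually_mono)
next
  case (Suc k)
  have k: "k < n" using Suc.prems(1) by simp
  have s: "0 \<le> s" using Suc.prems(4,8) by linarith
  have As: "A \<in> sets (F s)" using Suc.prems(5,8) by (rule sets_F_mono')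
  have AM[measurable]: "A \<in> sets M" using sets_F_D[OF s As] .
  have one: "AE \<omega> in M. \<omega> \<in> A \<longrightarrow> V (Suc k) \<nu>1 s \<omega> \<le> V (Suc k) \<nu>2 s \<omega>"
    if \<nu>: "\<nu>1 \<in> UF" "\<nu>2 \<in> UF" "agree_before M t \<nu>1 \<nu>2" "\<And>\<omega> r. \<omega> \<in> A \<Longrightarrow> \<nu>1 r \<omega> = \<nu>2 r \<omega>"
    for \<nu>1 \<nu>2
  proof -
    let ?X = "\<lambda>\<omega>. if \<omega> \<in> A then V (Suc k) \<nu>2 s \<omega> else \<infinity>"
    have "AE \<omega> in M. V (Suc k) \<nu>1 s \<omega> \<le> ?X \<omega>"
    proof (rule V_least[OF k \<nu>(1) s])
      have [measurable]: "V (Suc k) \<nu>2 s \<in> borel_measurable M"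
        using V_measurable k \<nu>(2) s by simp
      show "?X \<in> borel_measurable M" by measurable
      fix \<mu> assume "\<mu> \<in> controls_from M UF s \<nu>1"
      then have \<mu>: "\<mu> \<in> UF" and \<mu>_s: "agree_before M s \<mu> \<nu>1"
        by (auto simp: controls_from_def)
      have \<mu>_t: "agree_before M t \<mu> \<nu>2"
        using \<mu>_s \<nu>(3) unfolding agree_before_def
        by eventually_elim (use Suc.prems(8) in auto)
      \<comment> \<open>Off \<open>A\<close>, \<open>\<mu>\<close> follows \<open>\<nu>1\<close> up to time \<open>s\<close> and is not a competitor for \<open>\<nu>2\<close>. Pasting at the earlier
        time \<open>t\<close>, where all these controls still agree, turns it into one without changing it on \<open>A\<close>.\<close>
      let ?\<mu>' = "paste A \<mu> \<nu>2"
      have \<mu>': "?\<mu>' \<in> UF"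
        using \<mu> \<nu>(2) Suc.prems(4,5) \<mu>_t by (rule pasteI)
      have "agree_before M s ?\<mu>' \<nu>2"
        using \<mu>_s \<nu>(4) unfolding agree_before_def by (auto simp: paste_def elim: eventually_mono)
      with \<mu>' have \<mu>'_in: "?\<mu>' \<in> controls_from M UF s \<nu>2" by (simp add: controls_from_def)
      have "agree_before M t \<mu> ?\<mu>'"
        using \<mu>_t unfolding agree_before_def by eventually_elim (auto simp: paste_def)
      then have "AE \<omega> in M. \<omega> \<in> A \<longrightarrow> continuation k \<mu> s \<omega> = continuation k ?\<mu>' s \<omega>"
        using Suc.prems(8) k \<mu> \<mu>' Suc.prems(4,5)
        by (intro continuation_local[OF k \<mu> \<mu>' s As] Suc.IH) (auto simp: paste_def)
      moreover have "AE \<omega> in M. ereal (continuation k ?\<mu>' s \<omega>) \<le> V (Suc k) \<nu>2 s \<omega>"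
        using k \<nu>(2) s \<mu>'_in by (rule continuation_le_V)
      ultimately show "AE \<omega> in M. ereal (continuation k \<mu> s \<omega>) \<le> ?X \<omega>"
        by eventually_elim auto
    qed
    then show ?thesis by eventually_elim auto
  qed
  have ag: "agree_before M t \<nu>2 \<nu>1"
    using Suc.prems(6) unfolding agree_before_def by eventually_elim auto
  have "AE \<omega> in M. \<omega> \<in> A \<longrightarrow> V (Suc k) \<nu>1 s \<omega> \<le> V (Suc k) \<nu>2 s \<omega>"
    using Suc.prems(2,3,6) by (rule one) (rule Suc.prems(7))
  moreover have "AE \<omega> in M. \<omega> \<in> A \<longrightarrow> V (Suc k) \<nu>2 s \<omega> \<le> V (Suc k) \<nu>1 s \<omega>"
    using Suc.prems(3,2) ag by (rule one) (rule Suc.prems(7)[symmetric])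
  ultimately show ?case by eventually_elim auto
qed

text \<open>
  The pasted control follows the better of the two continuations, which is known at time \<open>t\<close>.
\<close>
lemma continuations_directed:
  assumes k: "k < n" and \<nu>: "\<nu> \<in> UF" and t: "0 \<le> t"
    and \<mu>1: "\<mu>1 \<in> controls_from M UF t \<nu>" and \<mu>2: "\<mu>2 \<in> controls_from M UF t \<nu>"
  shows "\<exists>\<mu>\<in>controls_from M UF t \<nu>. AE \<omega> in M.
    continuation k \<mu>1 t \<omega> \<le> continuation k \<mu> t \<omega> \<and> continuation k \<mu>2 t \<omega> \<le> continuation k \<mu> t \<omega>"
proof -
  interpret Ft: sigma_finite_subalgebra M "F t" using t by (rule sigma_finite_subalgebra_F)
  have U: "\<mu>1 \<in> UF" "\<mu>2 \<in> UF" and ag: "agree_before M t \<mu>1 \<nu>" "agree_before M t \<mu>2 \<nu>"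
    using \<mu>1 \<mu>2 by (auto simp: controls_from_def)
  have [measurable]: "continuation k \<mu> t \<in> borel_measurable (F t)" for \<mu>
    unfolding continuation_def by simp
  define A where "A = {\<omega> \<in> space (F t). continuation k \<mu>2 t \<omega> \<le> continuation k \<mu>1 t \<omega>}"
  have A: "A \<in> sets (F t)" unfolding A_def by measurable
  have A': "space (F t) - A \<in> sets (F t)" using A by auto
  let ?\<mu> = "paste A \<mu>1 \<mu>2"
  have ag12: "agree_before M t \<mu>1 \<mu>2"
    using ag unfolding agree_before_def by eventually_elim auto
  have \<mu>: "?\<mu> \<in> UF" using U t A ag12 by (rule pasteI)
  have "agree_before M t ?\<mu> \<nu>"
    using ag unfolding agree_before_def by eventually_elim (auto simp: paste_def)
  with \<mu> have in_c: "?\<mu> \<in> controls_from M UF t \<nu>" by (simp add: controls_from_def)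
  have ag1: "agree_before M t ?\<mu> \<mu>1" and ag2: "agree_before M t ?\<mu> \<mu>2"
    using ag12 unfolding agree_before_def by (auto simp: paste_def elim!: eventually_mono)
  have "AE \<omega> in M. \<omega> \<in> A \<longrightarrow> continuation k ?\<mu> t \<omega> = continuation k \<mu>1 t \<omega>"
    using k ag1 U \<mu> t A by (intro continuation_local[OF k \<mu> U(1) t A] V_local) (auto simp: paste_def)
  moreover have "AE \<omega> in M. \<omega> \<in> space (F t) - A \<longrightarrow> continuation k ?\<mu> t \<omega> = continuation k \<mu>2 t \<omega>"
    using k ag2 U \<mu> t A' by (intro continuation_local[OF k \<mu> U(2) t A'] V_local[where t = t])
      (auto simp: paste_def)
  ultimately have "AE \<omega> in M. continuation k \<mu>1 t \<omega> \<le> continuation k ?\<mu> t \<omega> \<and>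
      continuation k \<mu>2 t \<omega> \<le> continuation k ?\<mu> t \<omega>"
    using AE_space by eventually_elim (auto simp: A_def space_F)
  with in_c show ?thesis by blast
qed

section \<open>The recursion for mean values\<close>

definition mean_value :: "nat \<Rightarrow> (real \<Rightarrow> 'w \<Rightarrow> 'b) \<Rightarrow> real \<Rightarrow> real" where
  "mean_value k \<nu> t = expectation (\<lambda>\<omega>. real_of_ereal (V k \<nu> t \<omega>))"

lemma
  assumes "k \<le> n" "\<nu> \<in> UF" "0 \<le> t"
  shows AE_V_finite: "AE \<omega> in M. V k \<nu> t \<omega> = ereal (real_of_ereal (V k \<nu> t \<omega>))"
    and V_integrable: "integrable M (\<lambda>\<omega>. real_of_ereal (V k \<nu> t \<omega>))"
    and mean_value_bound: "\<bar>mean_value k \<nu> t\<bar> \<le> expectation (MY 0)"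
proof -
  have [measurable]: "V k \<nu> t \<in> borel_measurable M" using V_measurable assms .
  have dom: "AE \<omega> in M. \<bar>real_of_ereal (V k \<nu> t \<omega>)\<bar> \<le> MY t \<omega>"
    and "AE \<omega> in M. V k \<nu> t \<omega> = ereal (real_of_ereal (V k \<nu> t \<omega>))"
    using V_dominated[OF assms] by (eventually_elim, case_tac "V k \<nu> t \<omega>", auto)+
  then show "AE \<omega> in M. V k \<nu> t \<omega> = ereal (real_of_ereal (V k \<nu> t \<omega>))" by simp
  show int: "integrable M (\<lambda>\<omega>. real_of_ereal (V k \<nu> t \<omega>))"
    using dom by (intro Bochner_Integration.integrable_bound[OF MY_integrable[OF assms(3)]])
      (auto elim: eventually_mono)
  have "\<bar>mean_value k \<nu> t\<bar> \<le> (\<integral>\<omega>. \<bar>real_of_ereal (V k \<nu> t \<omega>)\<bar> \<partial>M)"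
    unfolding mean_value_def by (rule integral_abs_bound)
  also have "\<dots> \<le> expectation (MY t)"
    using integrable_abs[OF int] MY_integrable[OF assms(3)] dom by (rule integral_mono_AE)
  finally show "\<bar>mean_value k \<nu> t\<bar> \<le> expectation (MY 0)"
    using expectation_MY[OF assms(3)] by simp
qed

lemma mean_value_eq_Vbar:
  assumes "k < n" "\<nu> \<in> UF" "0 \<le> t"
  shows "mean_value k \<nu> t = expectation (Vbar k \<nu> t)"
  unfolding mean_value_def
proof (rule integral_cong_AE)
  show "(\<lambda>\<omega>. real_of_ereal (V k \<nu> t \<omega>)) \<in> borel_measurable M"
    using V_measurable[of k \<nu> t] assms by simp
  show "AE \<omega> in M. real_of_ereal (V k \<nu> t \<omega>) = Vbar k \<nu> t \<omega>"
    using AE_Vbar_eq_V[OF assms] by eventually_elim (metis real_of_ereal.simps(1))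
qed (rule Vbar_measurable[OF assms])

lemma
  assumes "k < n" "\<mu> \<in> UF" "0 \<le> t"
  shows continuation_integrable: "integrable M (continuation k \<mu> t)"
    and expectation_continuation:
      "expectation (continuation k \<mu> t) = (\<integral>z. mean_value k \<mu> (t + max 0 z) \<partial>law (n - k))"
    and mean_value_integrable: "integrable (law (n - k)) (\<lambda>z. mean_value k \<mu> (t + max 0 z))"
proof -
  interpret Ft: sigma_finite_subalgebra M "F t" using assms(3) by (rule sigma_finite_subalgebra_F)
  have eq: "mean_value k \<mu> (t + max 0 z) = expectation (Vbar k \<mu> (t + max 0 z))" for z
    using assms by (intro mean_value_eq_Vbar) auto
  show "integrable M (continuation k \<mu> t)"
    unfolding continuation_def using delayed_integrable[OF assms] assms by (intro Ft.real_cond_exp_int) auto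
  have "expectation (continuation k \<mu> t) = expectation (delayed k \<mu> t)"
    unfolding continuation_def using delayed_integrable[OF assms] assms by (intro Ft.real_cond_exp_int) auto
  also have "\<dots> = (\<integral>z. mean_value k \<mu> (t + max 0 z) \<partial>law (n - k))"
    unfolding eq using assms by (intro expectation_delayed)
  finally show "expectation (continuation k \<mu> t) = (\<integral>z. mean_value k \<mu> (t + max 0 z) \<partial>law (n - k))" .
  show "integrable (law (n - k)) (\<lambda>z. mean_value k \<mu> (t + max 0 z))"
    unfolding eq using assms by (intro expectation_Vbar_integrable)
qed

text \<open>The two halves of the recursion. The lower one holds since \<open>\<nu>\<close> competes with itself.\<close>
lemma mean_value_Suc_ge:
  assumes "k < n" "\<nu> \<in> UF" "0 \<le> t"
  shows "(\<integral>z. mean_value k \<nu> (t + max 0 z) \<partial>law (n - k)) \<le> mean_value (Suc k) \<nu> t"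
proof -
  have "AE \<omega> in M. continuation k \<nu> t \<omega> \<le> real_of_ereal (V (Suc k) \<nu> t \<omega>)"
    using continuation_le_V[OF assms self_in_controls_from[OF assms(2)]]
      AE_V_finite[OF Suc_leI[OF assms(1)] assms(2,3)]
    by eventually_elim (metis ereal_less_eq(3))
  then have "expectation (continuation k \<nu> t) \<le> mean_value (Suc k) \<nu> t"
    unfolding mean_value_def
    using continuation_integrable[OF assms] V_integrable[OF Suc_leI[OF assms(1)] assms(2,3)]
    by (intro integral_mono_AE)
  then show ?thesis using expectation_continuation[OF assms] by simp
qed

text \<open>
  The upper half is where directedness enters: it bounds the expectation of the essential supremum by
  the expectations of single continuation values.
\<close>
lemma mean_value_Suc_le:
  assumes k: "k < n" and \<nu>: "\<nu> \<in> UF" and t: "0 \<le> t"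
    and le: "\<And>\<mu>. \<mu> \<in> UF \<Longrightarrow> (\<integral>z. mean_value k \<mu> (t + max 0 z) \<partial>law (n - k)) \<le> c"
  shows "mean_value (Suc k) \<nu> t \<le> c"
  unfolding mean_value_def
proof (rule directed_ess_sup_integral_le)
  let ?S = "(\<lambda>\<mu>. continuation k \<mu> t) ` controls_from M UF t \<nu>"
  note fin = AE_V_finite[OF Suc_leI[OF k] \<nu> t] V_integrable[OF Suc_leI[OF k] \<nu> t]
  show "?S \<noteq> {}" using self_in_controls_from[OF \<nu>] by auto
  show "integrable M f" if "f \<in> ?S" for f
    using that continuation_integrable[OF k _ t] by (auto simp: controls_from_def)
  show "\<exists>h\<in>?S. AE x in M. f x \<le> h x \<and> g x \<le> h x" if "f \<in> ?S" "g \<in> ?S" for f g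
    using that continuations_directed[OF k \<nu> t] by auto
  show "expectation f \<le> c" if "f \<in> ?S" for f
    using that expectation_continuation[OF k _ t] le by (auto simp: controls_from_def)
  show "is_ess_sup M ((\<lambda>f x. ereal (f x)) ` ?S) (\<lambda>x. ereal (real_of_ereal (V (Suc k) \<nu> t x)))"
    using is_ess_sup_cong_AE[OF V_Suc_is_ess_sup[OF k \<nu> t] _ fin(1)] fin(2)
    by (simp add: image_image borel_measurable_integrable)
  show "integrable M (\<lambda>x. real_of_ereal (V (Suc k) \<nu> t x))" by (rule fin)
qed

section \<open>Unrolling the recursion\<close>

text \<open>
  Negative times are sent to \<open>0\<close>, so that the function is Borel measurable on the whole line; the
  maturities are nonnegative almost surely, and the convention is invisible under their laws.
\<close>
definition mean_payoff :: "(real \<Rightarrow> 'w \<Rightarrow> 'b) \<Rightarrow> real \<Rightarrow> real" where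
  "mean_payoff \<nu> t = expectation (Y \<nu> (max 0 t))"

lemma Y_integrable: "\<nu> \<in> UF \<Longrightarrow> 0 \<le> t \<Longrightarrow> integrable M (Y \<nu> t)"
  and mean_value_0: "\<nu> \<in> UF \<Longrightarrow> 0 \<le> t \<Longrightarrow> mean_value 0 \<nu> t = mean_payoff \<nu> t"
  using V_integrable[of 0 \<nu> t] by (auto simp: V_0 mean_value_def mean_payoff_def)

lemma mean_payoff_bound: "\<nu> \<in> UF \<Longrightarrow> \<bar>mean_payoff \<nu> t\<bar> \<le> expectation (MY 0)"
  using mean_value_bound[of 0 \<nu> "max 0 t"] mean_value_0[of \<nu> "max 0 t"]
  by (simp add: mean_payoff_def)

lemma mean_payoff_measurable:
  assumes "\<nu> \<in> UF"
  shows "mean_payoff \<nu> \<in> borel_measurable borel"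
proof -
  have "(\<lambda>p. Y \<nu> (max 0 (fst p)) (snd p)) \<in> borel_measurable (borel \<Otimes>\<^sub>M M)"
    by (intro measurable_pair_F_inf_D progressive_jointly_measurable progressive assms)
  then show ?thesis
    unfolding mean_payoff_def[abs_def]
    by (intro borel_measurable_lebesgue_integral) (simp add: split_beta')
qed

abbreviation laws :: "nat set \<Rightarrow> (nat \<Rightarrow> real) measure" where "laws I \<equiv> PiM I law"

lemma prob_space_laws: "I \<subseteq> {1..n} \<Longrightarrow> prob_space (laws I)"
  by (intro prob_space_PiM prob_space_law) auto

lemma mean_payoff_sum_measurable:
  assumes "\<nu> \<in> UF"
  shows "(\<lambda>w. mean_payoff \<nu> (t + (\<Sum>j\<in>I. w j))) \<in> borel_measurable (laws I)"
proof -
  note mean_payoff_measurable[OF assms, measurable]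
  have "(\<lambda>w. w j) \<in> borel_measurable (laws I)" if "j \<in> I" for j
    using measurable_component_singleton[OF that, of law] by simp
  then have "(\<lambda>w. t + (\<Sum>j\<in>I. w j)) \<in> borel_measurable (laws I)" by measurable
  then show ?thesis by measurable
qed

lemma mean_payoff_sum_integrable:
  assumes "\<nu> \<in> UF" "I \<subseteq> {1..n}"
  shows "integrable (laws I) (\<lambda>w. mean_payoff \<nu> (t + (\<Sum>j\<in>I. w j)))"
proof -
  interpret laws: prob_space "laws I" using assms(2) by (rule prob_space_laws)
  show ?thesis
    using mean_payoff_bound[OF assms(1)] mean_payoff_sum_measurable[OF assms(1)]
    by (intro laws.integrable_const_bound[where B = "expectation (MY 0)"]) auto
qed

lemma last_maturities_insert:
  assumes "k < n"
  shows "{n - Suc k<..n} = insert (n - k) {n - k<..n}"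
  using assms by auto

lemma sum_upd_insert:
  fixes w :: "'i \<Rightarrow> real"
  assumes "finite I" "i \<notin> I"
  shows "(\<Sum>j\<in>insert i I. (w(i := z)) j) = z + (\<Sum>j\<in>I. w j)"
proof -
  have "(\<Sum>j\<in>I. (w(i := z)) j) = (\<Sum>j\<in>I. w j)" using assms by (intro sum.cong) auto
  then show ?thesis using assms by simp
qed

text \<open>Keeping the same control at every stage iterates \<open>mean_value_Suc_ge\<close>.\<close>
lemma mean_value_ge:
  assumes "k \<le> n" "\<nu> \<in> UF" "0 \<le> t"
  shows "(\<integral>w. mean_payoff \<nu> (t + (\<Sum>j\<in>{n - k<..n}. w j)) \<partial>laws {n - k<..n}) \<le> mean_value k \<nu> t"
  using assms
proof (induction k arbitrary: t)
  case 0
  interpret laws: prob_space "laws {}" by (rule prob_space_laws) simp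
  show ?case using 0 by (simp add: mean_value_0 laws.prob_space)
next
  case (Suc k)
  then have k: "k < n" by simp
  have j: "n - k \<in> {1..n}" using k by auto
  let ?I = "{n - k<..n}" and ?i = "n - k"
  let ?f = "\<lambda>w. mean_payoff \<nu> (t + (\<Sum>j\<in>insert ?i ?I. w j))"
  have sub: "insert ?i ?I \<subseteq> {1..n}" using j by auto
  then have P: "\<And>j. j \<in> insert ?i ?I \<Longrightarrow> prob_space (law j)" using prob_space_law by blast
  have fint: "integrable (laws (insert ?i ?I)) ?f"
    using Suc.prems(2) sub by (rule mean_payoff_sum_integrable)
  have sect: "?f (w(?i := z)) = mean_payoff \<nu> (t + z + (\<Sum>j\<in>?I. w j))" for w z
    by (subst sum_upd_insert) (auto simp: add.assoc)
  have "(\<integral>w. ?f w \<partial>laws (insert ?i ?I))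
      = (\<integral>z. (\<integral>w. mean_payoff \<nu> (t + z + (\<Sum>j\<in>?I. w j)) \<partial>laws ?I) \<partial>law ?i)"
    using integral_PiM_insert[OF P _ fint] unfolding sect by simp
  also have "\<dots> \<le> (\<integral>z. mean_value k \<nu> (t + max 0 z) \<partial>law ?i)"
  proof (rule integral_mono_AE)
    show "integrable (law ?i) (\<lambda>z. \<integral>w. mean_payoff \<nu> (t + z + (\<Sum>j\<in>?I. w j)) \<partial>laws ?I)"
      using integrable_PiM_insert[OF P _ fint] unfolding sect by simp
    show "integrable (law ?i) (\<lambda>z. mean_value k \<nu> (t + max 0 z))"
      using mean_value_integrable k Suc.prems by simp
    show "AE z in law ?i. (\<integral>w. mean_payoff \<nu> (t + z + (\<Sum>j\<in>?I. w j)) \<partial>laws ?I)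
        \<le> mean_value k \<nu> (t + max 0 z)"
      using AE_law_nonneg[OF j]
    proof eventually_elim
      case (elim z)
      then show ?case using Suc.IH[of "t + z"] k Suc.prems by simp
    qed
  qed
  also have "\<dots> \<le> mean_value (Suc k) \<nu> t"
    using k Suc.prems by (intro mean_value_Suc_ge) auto
  finally show ?case by (simp only: last_maturities_insert[OF k])
qed

text \<open>
  In the step, almost every value \<open>z\<close> of the new maturity leaves a section of \<open>h\<close> that bounds the mean
  payoffs from time \<open>t + z\<close> on, so the induction hypothesis applies to that section. The bound has
  to be uniform in the control inside the almost-sure quantifier, since the control may be
  chosen after the maturities are revealed.
\<close>
lemma mean_value_le:
  assumes "k \<le> n" "\<nu> \<in> UF" "0 \<le> t" "integrable (laws {n - k<..n}) h"
    and "AE w in laws {n - k<..n}. \<forall>\<mu>\<in>UF. mean_payoff \<mu> (t + (\<Sum>j\<in>{n - k<..n}. w j)) \<le> h w"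
  shows "mean_value k \<nu> t \<le> (\<integral>w. h w \<partial>laws {n - k<..n})"
  using assms
proof (induction k arbitrary: \<nu> t h)
  case 0
  interpret laws: prob_space "laws {}" by (rule prob_space_laws) simp
  have "AE w in laws {}. mean_value 0 \<nu> t \<le> h w"
    using 0(2,3) 0(5)[unfolded diff_zero greaterThanAtMost_empty[OF order_refl]]
    by (auto simp: mean_value_0 elim: eventually_mono)
  then have "(\<integral>w. mean_value 0 \<nu> t \<partial>laws {}) \<le> (\<integral>w. h w \<partial>laws {})"
    using 0(4) by (intro integral_mono_AE) auto
  then show ?case by (simp add: laws.prob_space)
next
  case (Suc k)
  then have k: "k < n" by simp
  have j: "n - k \<in> {1..n}" using k by auto
  let ?I = "{n - k<..n}" and ?i = "n - k"
  have sub: "insert ?i ?I \<subseteq> {1..n}" using j by auto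
  then have P: "\<And>j. j \<in> insert ?i ?I \<Longrightarrow> prob_space (law j)" using prob_space_law by blast
  have h: "integrable (laws (insert ?i ?I)) h"
    using Suc.prems(4) by (simp only: last_maturities_insert[OF k])
  have "AE w in laws (insert ?i ?I). \<forall>\<mu>\<in>UF. mean_payoff \<mu> (t + (\<Sum>j\<in>insert ?i ?I. w j)) \<le> h w"
    using Suc.prems(5) by (simp only: last_maturities_insert[OF k])
  note ae = AE_PiM_insert[OF P _ this]
  have sect: "(\<Sum>j\<in>insert ?i ?I. (w(?i := z)) j) = z + (\<Sum>j\<in>?I. w j)"
    for w :: "nat \<Rightarrow> real" and z
    by (rule sum_upd_insert) auto
  have "mean_value (Suc k) \<nu> t \<le> (\<integral>z. (\<integral>w. h (w(?i := z)) \<partial>laws ?I) \<partial>law ?i)"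
  proof (rule mean_value_Suc_le[OF k Suc.prems(2,3)])
    fix \<mu> assume \<mu>: "\<mu> \<in> UF"
    show "(\<integral>z. mean_value k \<mu> (t + max 0 z) \<partial>law ?i) \<le> (\<integral>z. (\<integral>w. h (w(?i := z)) \<partial>laws ?I) \<partial>law ?i)"
    proof (rule integral_mono_AE)
      show "integrable (law ?i) (\<lambda>z. mean_value k \<mu> (t + max 0 z))"
        using mean_value_integrable[OF k \<mu> Suc.prems(3)] .
      show "integrable (law ?i) (\<lambda>z. \<integral>w. h (w(?i := z)) \<partial>laws ?I)"
        using integrable_PiM_insert[OF P _ h] by simp
      have "AE z in law ?i. integrable (laws ?I) (\<lambda>w. h (w(?i := z)))"
        using AE_integrable_PiM_insert[OF P _ h] by simp
      moreover have "AE z in law ?i. AE w in laws ?I.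
          \<forall>\<mu>\<in>UF. mean_payoff \<mu> (t + (\<Sum>j\<in>insert ?i ?I. (w(?i := z)) j)) \<le> h (w(?i := z))"
        by (rule ae) auto
      ultimately show "AE z in law ?i. mean_value k \<mu> (t + max 0 z) \<le> (\<integral>w. h (w(?i := z)) \<partial>laws ?I)"
        using AE_law_nonneg[OF j] unfolding sect
      proof eventually_elim
        case (elim z)
        then show ?case
          using Suc.IH[OF less_imp_le[OF k] \<mu>, of "t + z" "\<lambda>w. h (w(?i := z))"] Suc.prems(3)
          by (simp add: add.assoc)
      qed
    qed
  qed
  also have "\<dots> = (\<integral>w. h w \<partial>laws (insert ?i ?I))"
    using integral_PiM_insert[OF P _ h] by simp
  finally show ?case by (simp only: last_maturities_insert[OF k])
qed

section \<open>The initial value\<close>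

text \<open>
  At time zero all controls compete, and their continuation values are constants because \<open>F 0\<close> is
  trivial. The essential supremum of a family of constants is their supremum, approached along a
  maximizing sequence.
\<close>
lemma initial_value_constant:
  assumes triv: "trivial_sigma_algebra M (F 0)" and n: "1 \<le> n" and \<nu>: "\<nu> \<in> UF"
  shows "AE \<omega> in M. V n \<nu> 0 \<omega> = ereal (SUP \<mu>\<in>UF. expectation (delayed (n - 1) \<mu> 0))"
proof -
  let ?k = "n - 1"
  have k: "?k < n" and Suc_k: "Suc ?k = n" using n by auto
  define c where "c \<mu> = expectation (delayed ?k \<mu> 0)" for \<mu>
  define v where "v = (SUP \<mu>\<in>UF. c \<mu>)"
  have cont: "AE \<omega> in M. continuation ?k \<mu> 0 \<omega> = c \<mu>" if "\<mu> \<in> UF" for \<mu>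
    unfolding continuation_def c_def
    using triv delayed_integrable[OF k that] that by (intro real_cond_exp_trivial subalgebra_F) auto
  have from_0: "controls_from M UF 0 \<nu> = UF" by (auto simp: controls_from_def agree_before_def)
  have c_le_V: "AE \<omega> in M. ereal (c \<mu>) \<le> V n \<nu> 0 \<omega>" if "\<mu> \<in> UF" for \<mu>
    using continuation_le_V[OF k \<nu>, of 0 \<mu>] cont[OF that] that unfolding from_0 Suc_k
    by (auto elim: eventually_elim2)
  have bdd: "bdd_above (c ` UF)"
  proof (rule bdd_aboveI2)
    fix \<mu> assume \<mu>: "\<mu> \<in> UF"
    have "c \<mu> = (\<integral>\<omega>. continuation ?k \<mu> 0 \<omega> \<partial>M)"
      using cont[OF \<mu>] continuation_integrable[OF k \<mu>, of 0] integral_cong_AE[of "continuation ?k \<mu> 0" M "\<lambda>_. c \<mu>"]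
      by (simp add: prob_space borel_measurable_integrable)
    also have "\<dots> \<le> expectation (MY 0)"
      using continuation_dominated[OF k \<mu>, of 0] \<mu> continuation_integrable[OF k \<mu>, of 0] MY_integrable[of 0]
      by (intro integral_mono_AE) (auto elim: eventually_mono)
    finally show "c \<mu> \<le> expectation (MY 0)" .
  qed
  have c_le_v: "c \<mu> \<le> v" if "\<mu> \<in> UF" for \<mu>
    unfolding v_def using that bdd by (rule cSUP_upper)
  have le: "AE \<omega> in M. V n \<nu> 0 \<omega> \<le> ereal v"
  proof -
    have "AE \<omega> in M. V (Suc ?k) \<nu> 0 \<omega> \<le> ereal v"
    proof (rule V_least[OF k \<nu>])
      fix \<mu> assume "\<mu> \<in> controls_from M UF 0 \<nu>"
      then have "\<mu> \<in> UF" by (simp add: from_0)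
      from cont[OF this] c_le_v[OF this]
      show "AE \<omega> in M. ereal (continuation ?k \<mu> 0 \<omega>) \<le> ereal v" by (auto elim: eventually_mono)
    qed auto
    then show ?thesis by (simp only: Suc_k)
  qed
  have "AE \<omega> in M. ereal (v - 1 / Suc i) \<le> V n \<nu> 0 \<omega>" for i :: nat
  proof -
    have "\<exists>\<mu>\<in>UF. v - 1 / Suc i < c \<mu>"
      using less_cSUP_iff[OF _ bdd, of "v - 1 / Suc i"] \<nu> unfolding v_def[symmetric] by auto
    then obtain \<mu> where "\<mu> \<in> UF" "v - 1 / Suc i < c \<mu>" by blast
    from c_le_V[OF this(1)] show ?thesis
      by eventually_elim (use \<open>v - 1 / Suc i < c \<mu>\<close> in \<open>auto intro: order_trans[rotated]\<close>)
  qed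
  then have "AE \<omega> in M. \<forall>i::nat. ereal (v - 1 / Suc i) \<le> V n \<nu> 0 \<omega>" by (simp add: AE_all_countable)
  then show ?thesis
    using le unfolding c_def[symmetric] v_def[symmetric]
  proof eventually_elim
    case (elim \<omega>)
    have "(\<lambda>i. ereal (v - 1 / Suc i)) \<longlonglongrightarrow> ereal (v - 0)"
      by (intro tendsto_intros LIMSEQ_Suc lim_1_over_n)
    then have "ereal v \<le> V n \<nu> 0 \<omega>"
      using elim(1) by (intro LIMSEQ_le_const2[of "\<lambda>i. ereal (v - 1 / Suc i)"]) auto
    with elim(2) show ?case by (rule antisym)
  qed
qed

lemma maturity_law_eq:
  assumes "1 \<le> n" "indep_vars (\<lambda>_. borel) \<zeta> {1..n}"
  shows "maturity_law M n \<zeta> = laws {1..n}"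
proof -
  have "distr M (PiM {1..n} (\<lambda>_. borel)) (\<lambda>\<omega>. \<lambda>j\<in>{1..n}. \<zeta> j \<omega>) = laws {1..n}"
    using assms maturity_measurable by (subst indep_vars_iff_distr_eq_PiM'[symmetric]) auto
  then show ?thesis by (simp add: maturity_law_def maturity_vector_def[abs_def])
qed

text \<open>
  The state is evaluated at the sum of all maturities at once. Independence of each of them from
  \<open>F\<^sub>\<infinity>\<close> would not give independence of the sum, hence the hypothesis on the vector.
\<close>
lemma expectation_at_maturity:
  assumes \<nu>: "\<nu> \<in> UF"
    and ind: "independent_of M (Pi\<^sub>M {1..n} (\<lambda>_. borel)) (maturity_vector n \<zeta>) F_inf"
  shows "expectation (\<lambda>\<omega>. Y \<nu> (maturity_time \<zeta> n \<omega>) \<omega>)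
    = (\<integral>w. mean_payoff \<nu> (\<Sum>j=1..n. w j) \<partial>maturity_law M n \<zeta>)"
proof -
  let ?N = "Pi\<^sub>M {1..n} (\<lambda>_::nat. borel :: real measure)"
  define f where "f p = Y \<nu> (max 0 (\<Sum>j=1..n. fst p j)) (snd p)" for p :: "(nat \<Rightarrow> real) \<times> 'w"
  have sm: "(\<lambda>w. \<Sum>j=1..n. w j) \<in> borel_measurable ?N" by measurable
  have "(\<lambda>p. (\<Sum>j=1..n. fst p j, snd p)) \<in> ?N \<Otimes>\<^sub>M F_inf \<rightarrow>\<^sub>M borel \<Otimes>\<^sub>M F_inf"
    using measurable_compose[OF measurable_fst sm] by (rule measurable_Pair) simp
  from measurable_compose[OF this progressive_jointly_measurable[OF progressive[OF \<nu>]]]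
  have f: "f \<in> borel_measurable (?N \<Otimes>\<^sub>M F_inf)" by (simp add: f_def[abs_def])
  have "integrable M (\<lambda>\<omega>. f (w, \<omega>)) \<and> (\<integral>\<omega>. \<bar>f (w, \<omega>)\<bar> \<partial>M) \<le> expectation (MY 0)" for w
  proof -
    define s where "s = max 0 (\<Sum>j=1..n. w j)"
    have s: "0 \<le> s" by (simp add: s_def)
    have "(\<integral>\<omega>. \<bar>Y \<nu> s \<omega>\<bar> \<partial>M) \<le> expectation (MY s)"
      using Y_integrable[OF \<nu> s] MY_integrable[OF s] Y_le_MY[OF \<nu>] s
      by (intro integral_mono_AE) (auto elim: eventually_mono)
    then show ?thesis
      using Y_integrable[OF \<nu> s] expectation_MY[OF s] by (simp add: f_def s_def)
  qed
  then have bound: "AE w in distr M ?N (maturity_vector n \<zeta>).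
      integrable M (\<lambda>\<omega>. f (w, \<omega>)) \<and> (\<integral>\<omega>. \<bar>f (w, \<omega>)\<bar> \<partial>M) \<le> expectation (MY 0)" by simp
  have "expectation (\<lambda>\<omega>. Y \<nu> (maturity_time \<zeta> n \<omega>) \<omega>) = (\<integral>\<omega>. f (maturity_vector n \<zeta> \<omega>, \<omega>) \<partial>M)"
  proof (rule Bochner_Integration.integral_cong[OF refl])
    fix \<omega> assume "\<omega> \<in> space M"
    then have "0 \<le> maturity_time \<zeta> n \<omega>"
      unfolding maturity_time_def using maturity_nonneg by (intro sum_nonneg) auto
    moreover have "(\<Sum>j=1..n. maturity_vector n \<zeta> \<omega> j) = maturity_time \<zeta> n \<omega>"
      by (simp add: maturity_vector_def maturity_time_def)
    ultimately show "Y \<nu> (maturity_time \<zeta> n \<omega>) \<omega> = f (maturity_vector n \<zeta> \<omega>, \<omega>)"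
      by (simp add: f_def)
  qed
  also have "\<dots> = (\<integral>w. (\<integral>\<omega>. f (w, \<omega>) \<partial>M) \<partial>maturity_law M n \<zeta>)"
    using integral_at_independent[OF ind subalgebra_F_inf f bound] by (simp add: maturity_law_def)
  finally show ?thesis by (simp add: f_def mean_payoff_def)
qed

end

theorem theorem3p1:
  fixes M :: "'w measure"
    and F :: "real \<Rightarrow> 'w measure"
    and U :: "(real \<Rightarrow> real ^ 'd) set"
    and UF :: "(real \<Rightarrow> 'w \<Rightarrow> real ^ 'd) set"
    and Y :: "(real \<Rightarrow> 'w \<Rightarrow> real ^ 'd) \<Rightarrow> real \<Rightarrow> 'w \<Rightarrow> real"
    and Y0 :: "'w \<Rightarrow> real"
    and MY :: "real \<Rightarrow> 'w \<Rightarrow> real"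
    and n :: nat
    and \<zeta> :: "nat \<Rightarrow> 'w \<Rightarrow> real"
    and V :: "nat \<Rightarrow> (real \<Rightarrow> 'w \<Rightarrow> real ^ 'd) \<Rightarrow> real \<Rightarrow> 'w \<Rightarrow> ereal"
    and Vbar :: "nat \<Rightarrow> (real \<Rightarrow> 'w \<Rightarrow> real ^ 'd) \<Rightarrow> real \<Rightarrow> 'w \<Rightarrow> real"
  assumes "prob_space M"
    and "filtration (space M) F"
    and "\<And>t. t \<ge> 0 \<Longrightarrow> subalgebra M (F t)"
    and "usual_conditions M F"
    and "trivial_sigma_algebra M (F 0)"
    and "UF \<subseteq> pre_controls M F U"
    and "UF \<noteq> {}"
    and "\<And>\<nu>. \<nu> \<in> pre_controls M F U \<Longrightarrow> progressively_measurable F (Y \<nu>)"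
    and "\<And>\<nu>. \<nu> \<in> pre_controls M F U \<Longrightarrow> AE \<omega> in M. Y \<nu> 0 \<omega> = Y0 \<omega>"
    and "local_in_control M F UF Y"
    and HU: "stable_under_pasting M F UF"
    and "n \<ge> 1"
    and "\<And>j. j \<in> {1..n} \<Longrightarrow> \<zeta> j \<in> randomized_maturities M F"
    and "prob_space.indep_vars M (\<lambda>_. borel) \<zeta> {1..n}"
    and "independent_of M (Pi\<^sub>M {1..n} (\<lambda>_. borel)) (maturity_vector n \<zeta>) (F_infinity M F)"
    and "maturity_algorithm M F UF Y n \<zeta> V Vbar"
    and HY: "martingale M F MY" "uniformly_integrable M MY"
      "\<And>\<nu>. \<nu> \<in> UF \<Longrightarrow> AE \<omega> in M. \<forall>t\<ge>0. \<bar>Y \<nu> t \<omega>\<bar> \<le> MY t \<omega>"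
    and HV: "\<And>\<nu> k. \<nu> \<in> UF \<Longrightarrow> k \<in> {1..n - 1} \<Longrightarrow> aggregates M F (Vbar k \<nu>) (V k \<nu>)"
  shows "\<exists>v::real.
      (\<forall>\<nu>\<in>UF. AE \<omega> in M. V n \<nu> 0 \<omega> = ereal v) \<and>
      (SUP \<nu>\<in>UF. ereal (\<integral>\<omega>. Y \<nu> (maturity_time \<zeta> n \<omega>) \<omega> \<partial>M)) \<le> ereal v \<and>
      ereal v \<le> upper_integral (maturity_law M n \<zeta>)
        (\<lambda>z. SUP \<nu>\<in>UF. ereal (\<integral>\<omega>. Y \<nu> (\<Sum>j=1..n. z j) \<omega> \<partial>M))"
proof -
  interpret prob_space M by fact
  interpret filtration "space M" F by fact
  interpret randomized_maturity_problem M F UF Y MY n \<zeta> V Vbar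
    using assms by unfold_locales blast+
  have n: "1 \<le> n" by fact
  have I: "{n - n<..n} = {1..n}" by auto
  have law: "maturity_law M n \<zeta> = laws {1..n}" using n assms by (intro maturity_law_eq) blast+
  define v where "v = (SUP \<mu>\<in>UF. expectation (delayed (n - 1) \<mu> 0))"
  have V_v: "AE \<omega> in M. V n \<nu> 0 \<omega> = ereal v" if "\<nu> \<in> UF" for \<nu>
    unfolding v_def using assms(5) n that by (rule initial_value_constant)
  have mean_v: "mean_value n \<nu> 0 = v" if \<nu>: "\<nu> \<in> UF" for \<nu>
  proof -
    have "mean_value n \<nu> 0 = (\<integral>\<omega>. v \<partial>M)"
      unfolding mean_value_def using V_v[OF \<nu>] V_measurable[of n \<nu> 0] \<nu>
      by (intro integral_cong_AE) (auto elim: eventually_mono)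
    then show ?thesis by (simp add: prob_space)
  qed
  have lower: "expectation (\<lambda>\<omega>. Y \<nu> (maturity_time \<zeta> n \<omega>) \<omega>) \<le> v" if \<nu>: "\<nu> \<in> UF" for \<nu>
    using expectation_at_maturity[OF \<nu> assms(15)] mean_value_ge[of n \<nu> 0, unfolded I] mean_v[OF \<nu>] \<nu>
    by (simp add: law)
  have upper: "ereal v \<le> ereal (\<integral>z. h z \<partial>maturity_law M n \<zeta>)"
    if h: "integrable (maturity_law M n \<zeta>) h"
      "AE z in maturity_law M n \<zeta>. (SUP \<nu>\<in>UF. ereal (\<integral>\<omega>. Y \<nu> (\<Sum>j=1..n. z j) \<omega> \<partial>M)) \<le> ereal (h z)" for h
  proof -
    obtain \<nu> where \<nu>: "\<nu> \<in> UF" using assms(7) by blast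
    have "AE z in laws {1..n}. 0 \<le> z j" if j: "j \<in> {1..n}" for j
      using prob_space_law AE_law_nonneg[OF j] j by (intro AE_PiM_component) auto
    then have "AE z in laws {1..n}. \<forall>j\<in>{1..n}. 0 \<le> z j" by (intro AE_finite_allI) auto
    with h(2)[unfolded law]
    have "AE z in laws {1..n}. \<forall>\<mu>\<in>UF. mean_payoff \<mu> (\<Sum>j=1..n. z j) \<le> h z"
    proof eventually_elim
      case (elim z)
      then have "0 \<le> (\<Sum>j=1..n. z j)" by (intro sum_nonneg) auto
      with elim(1) show ?case by (auto simp: mean_payoff_def SUP_le_iff)
    qed
    then show ?thesis
      using mean_value_le[of n \<nu> 0 h, unfolded I] mean_v[OF \<nu>] \<nu> h(1) by (simp add: law)
  qed
  show ?thesis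
  proof (intro exI[of _ v] conjI ballI)
    show "AE \<omega> in M. V n \<nu> 0 \<omega> = ereal v" if "\<nu> \<in> UF" for \<nu> using that by (rule V_v)
    show "(SUP \<nu>\<in>UF. ereal (\<integral>\<omega>. Y \<nu> (maturity_time \<zeta> n \<omega>) \<omega> \<partial>M)) \<le> ereal v"
      using lower by (intro SUP_least) simp
    show "ereal v \<le> upper_integral (maturity_law M n \<zeta>)
        (\<lambda>z. SUP \<nu>\<in>UF. ereal (\<integral>\<omega>. Y \<nu> (\<Sum>j=1..n. z j) \<omega> \<partial>M))"
      unfolding upper_integral_def using upper by (intro INF_greatest) auto
  qed
qed

end
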